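(* If $G$ is an outerplanar graph with $s\ell(G)\geq 2$, then $\gamma(G)\leq 6\,s\ell(G)-6$.
   Context: All graphs are finite, simple, and undirected. A graph is outerplanar if it can be embedded in the plane such that all its vertices lie on the boundary of the unbounded face. A set $D\subseteq V(G)$ is a dominating set of $G$ if every vertex in $V(G)\setminus D$ has a neighbor in $D$; the domination number $\gamma(G)$ is the minimum order of a dominating set of $G$. For a graph $G$ of order $n\geq 1$ with non-increasing degree sequence $d_1\geq \ldots\geq d_n$, the Slater number is $s\ell(G)=\min\{ s: (d_1+1)+\cdots+(d_s+1)\geq n\}$, the minimum being over positive integers $s$. *)

theory Defs
  imports "HOL-Analysis.Analysis" "HOL-Library.Multiset"
begin

definition finite_simple_graph :: "'a set \<Rightarrow> 'a set set \<Rightarrow> bool" where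
  "finite_simple_graph V E \<longleftrightarrow> finite V \<and> (\<forall>e\<in>E. e \<subseteq> V \<and> card e = 2)"

definition neighbors :: "'a set set \<Rightarrow> 'a \<Rightarrow> 'a set" where
  "neighbors E v = {u. {u, v} \<in> E}"

definition vertex_degree :: "'a set set \<Rightarrow> 'a \<Rightarrow> nat" where
  "vertex_degree E v = card (neighbors E v)"

text \<open>
  In a plane embedding, \<open>p\<close> gives the positions of the vertices, and every edge \<open>e\<close> is drawn as
  the simple arc \<open>c e\<close> between the positions of its two ends. The last two conditions say that
  the interior of an arc contains no vertex and meets no other arc.
\<close>
definition plane_embedding ::
    "'a set \<Rightarrow> 'a set set \<Rightarrow> ('a \<Rightarrow> complex) \<Rightarrow> ('a set \<Rightarrow> real \<Rightarrow> complex) \<Rightarrow> bool" where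
  "plane_embedding V E p c \<longleftrightarrow>
     inj_on p V \<and>
     (\<forall>e\<in>E. arc (c e) \<and> {pathstart (c e), pathfinish (c e)} = p ` e) \<and>
     (\<forall>e\<in>E. path_image (c e) \<inter> p ` V = p ` e) \<and>
     (\<forall>e\<in>E. \<forall>f\<in>E. e \<noteq> f \<longrightarrow> path_image (c e) \<inter> path_image (c f) \<subseteq> p ` (e \<inter> f))"

definition drawing ::
    "'a set \<Rightarrow> 'a set set \<Rightarrow> ('a \<Rightarrow> complex) \<Rightarrow> ('a set \<Rightarrow> real \<Rightarrow> complex) \<Rightarrow> complex set" where
  "drawing V E p c = p ` V \<union> (\<Union>e\<in>E. path_image (c e))"

text \<open>
  The drawing of a finite graph is compact, so its complement has exactly one unbounded
  component, and \<open>outside (drawing V E p c)\<close> is that component, the unbounded face.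
\<close>
definition outerplanar :: "'a set \<Rightarrow> 'a set set \<Rightarrow> bool" where
  "outerplanar V E \<longleftrightarrow>
     (\<exists>p c. plane_embedding V E p c \<and> p ` V \<subseteq> frontier (outside (drawing V E p c)))"

definition dominating_set :: "'a set \<Rightarrow> 'a set set \<Rightarrow> 'a set \<Rightarrow> bool" where
  "dominating_set V E D \<longleftrightarrow> D \<subseteq> V \<and> (\<forall>v\<in>V - D. neighbors E v \<inter> D \<noteq> {})"

definition domination_number :: "'a set \<Rightarrow> 'a set set \<Rightarrow> nat" where
  "domination_number V E = (LEAST k. \<exists>D. dominating_set V E D \<and> card D = k)"

definition degree_sequence :: "'a set \<Rightarrow> 'a set set \<Rightarrow> nat list" where
  "degree_sequence V E = rev (sorted_list_of_multiset (image_mset (vertex_degree E) (mset_set V)))"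

text \<open>
  For a nonempty graph of order \<open>n\<close> the minimum is attained at some \<open>s \<le> n\<close>, where \<open>take s\<close> yields
  exactly the \<open>s\<close> largest degrees. On the empty graph the value is \<open>1\<close>.
\<close>
definition slater_number :: "'a set \<Rightarrow> 'a set set \<Rightarrow> nat" where
  "slater_number V E =
     (LEAST s. s \<ge> 1 \<and> (\<Sum>d\<leftarrow>take s (degree_sequence V E). d + 1) \<ge> card V)"

end

theory Submission
  imports Defs
begin

text \<open>
  Let \<open>S\<close> consist of \<open>s\<close> vertices of largest degree, where \<open>s\<close> is the Slater number, and let
  \<open>N = V - S\<close>. Counting closed neighbourhoods shows that at most
  \<open>excess = (\<Sum>u\<in>S. deg\<^sub>S u) + (\<Sum>v\<in>N. deg\<^sub>S v - 1)\<close> vertices are not dominated by \<open>S\<close> (the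
  subtraction is truncated), so it suffices to show \<open>excess \<le> 5 s - 6\<close>.

  Outerplanarity enters only through the absence of a \<open>K\<^bsub>2,3\<^esub>\<close> minor: such a minor yields a theta
  curve each of whose three arcs has an interior vertex on the outer face, whereas one arc of
  a theta curve always runs inside the other two.

  The bound on the excess is proved by induction. A vertex of \<open>N\<close> with at least four neighbours
  in \<open>S\<close> can be moved to \<open>S\<close>, and one with at most three, two of them nonadjacent, can be contracted
  into one of these two.
  Otherwise an edge of \<open>S\<close> lying in at most one triangle of \<open>S\<close> is contracted, which
  costs at most 5; if there is no such edge, \<open>S\<close> contains a \<open>K\<^sub>4\<close>, which is contracted to a vertex.
\<close>

section \<open>Minors and contractions\<close>

text \<open>Connectedness is expressed by cuts instead of walks, so that it pulls back along a
  contraction by a case distinction on the cut. Nonemptiness is included because the branch sets of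
  a minor must be nonempty.\<close>

definition connected_in :: "('a \<Rightarrow> 'a \<Rightarrow> bool) \<Rightarrow> 'a set \<Rightarrow> bool" where
  "connected_in r A \<longleftrightarrow>
     A \<noteq> {} \<and> (\<forall>X \<subseteq> A. X \<noteq> {} \<longrightarrow> X \<noteq> A \<longrightarrow> (\<exists>x\<in>X. \<exists>y\<in>A - X. r x y))"

definition touches :: "('a \<Rightarrow> 'a \<Rightarrow> bool) \<Rightarrow> 'a set \<Rightarrow> 'a set \<Rightarrow> bool" where
  "touches r A B \<longleftrightarrow> (\<exists>x\<in>A. \<exists>y\<in>B. r x y)"

text \<open>A model of the minor: \<open>A\<close> and \<open>B\<close> are the branch sets of the
  side with two vertices, \<open>C 0\<close>, \<open>C 1\<close>, \<open>C 2\<close> those of the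
  side with three.\<close>

definition K23_minor :: "('a \<Rightarrow> 'a \<Rightarrow> bool) \<Rightarrow> 'a set \<Rightarrow> bool" where
  "K23_minor r V \<longleftrightarrow>
     (\<exists>A B C. A \<subseteq> V \<and> B \<subseteq> V \<and> A \<inter> B = {} \<and> connected_in r A \<and> connected_in r B \<and>
        (\<forall>i<3::nat. C i \<subseteq> V \<and> C i \<inter> (A \<union> B) = {} \<and> connected_in r (C i) \<and>
           touches r A (C i) \<and> touches r B (C i)) \<and>
        (\<forall>i<3. \<forall>j<3. i \<noteq> j \<longrightarrow> C i \<inter> C j = {}))"

lemma K23_minorE:
  assumes "K23_minor r V"
  obtains A B C where "A \<subseteq> V" "B \<subseteq> V" "A \<inter> B = {}" "connected_in r A" "connected_in r B"
    "\<And>i. i < (3::nat) \<Longrightarrow> C i \<subseteq> V \<and> C i \<inter> (A \<union> B) = {} \<and> connected_in r (C i) \<and>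
       touches r A (C i) \<and> touches r B (C i)"
    "\<And>i j. i < 3 \<Longrightarrow> j < 3 \<Longrightarrow> i \<noteq> j \<Longrightarrow> C i \<inter> C j = {}"
  using assms unfolding K23_minor_def by metis

lemma connected_in_nonempty: "connected_in r A \<Longrightarrow> A \<noteq> {}"
  by (simp add: connected_in_def)

lemma connected_inE:
  assumes "connected_in r A" "X \<subseteq> A" "X \<noteq> {}" "X \<noteq> A"
  obtains x y where "x \<in> X" "y \<in> A - X" "r x y"
  using assms unfolding connected_in_def by blast

lemma connected_in_singleton: "connected_in r {x}"
  unfolding connected_in_def by blast

lemma connected_in_insert:
  assumes r: "symp r" and A: "connected_in r A" and xy: "y \<in> A" "r x y"
  shows "connected_in r (insert x A)"
  unfolding connected_in_def
proof (intro conjI allI impI)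
  fix X assume X: "X \<subseteq> insert x A" "X \<noteq> {}" "X \<noteq> insert x A"
  have yx: "r y x" using r xy by (simp add: sympD)
  show "\<exists>u\<in>X. \<exists>v\<in>insert x A - X. r u v"
  proof (cases "X \<inter> A = {} \<or> A \<subseteq> X")
    case True
    then show ?thesis
    proof
      assume "X \<inter> A = {}"
      then have "X = {x}" "x \<notin> A \<or> False" using X by auto
      then show ?thesis using xy \<open>X \<inter> A = {}\<close> by auto
    next
      assume "A \<subseteq> X"
      then have "x \<notin> X" using X by auto
      then show ?thesis using xy yx \<open>A \<subseteq> X\<close> by auto
    qed
  next
    case False
    then have "X \<inter> A \<noteq> {}" "X \<inter> A \<noteq> A" by auto
    then obtain u v where "u \<in> X \<inter> A" "v \<in> A - X \<inter> A" "r u v"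
      using connected_inE[OF A, of "X \<inter> A"] by blast
    then show ?thesis by auto
  qed
qed simp

lemma connected_in_edge:
  assumes "symp r" "r x y"
  shows "connected_in r {x, y}"
  using connected_in_insert[OF assms(1) connected_in_singleton, of y y x] assms by simp

lemma connected_in_clique:
  assumes "T \<noteq> {}" "\<forall>x\<in>T. \<forall>y\<in>T. x \<noteq> y \<longrightarrow> r x y"
  shows "connected_in r T"
  unfolding connected_in_def
proof (intro conjI allI impI)
  fix X assume "X \<subseteq> T" "X \<noteq> {}" "X \<noteq> T"
  then obtain x y where "x \<in> X" "y \<in> T - X" by blast
  moreover from this have "x \<in> T" "y \<in> T" "x \<noteq> y" using \<open>X \<subseteq> T\<close> by auto
  ultimately show "\<exists>x\<in>X. \<exists>y\<in>T - X. r x y" using assms(2) by metis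
qed (use assms in simp)

lemma connected_in_successively:
  assumes "symp r" "successively r xs" "xs \<noteq> []"
  shows "connected_in r (set xs)"
  using assms(2,3)
proof (induction xs rule: induct_list012)
  case (3 x y zs)
  then show ?case
    using connected_in_insert[OF assms(1), of "set (y # zs)" y x] by simp
qed (auto intro: connected_in_singleton)

text \<open>Three common neighbours, taken as singletons together with \<open>{a}\<close> and
  \<open>{b}\<close>, would already be a K_{2,3} subgraph. Irreflexivity keeps them apart from
  \<open>a\<close> and \<open>b\<close>.\<close>

lemma card_common_neighbors_le_2:
  assumes r: "irreflp r" "symp r" and no: "\<not> K23_minor r V"
    and ab: "a \<in> V" "b \<in> V" "a \<noteq> b" and W: "W \<subseteq> {w\<in>V. r w a \<and> r w b}" "finite W"
  shows "card W \<le> 2"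
proof (rule ccontr)
  assume "\<not> card W \<le> 2"
  then have "3 \<le> card W" by simp
  then obtain W' where W': "W' \<subseteq> W" "card W' = 3" "finite W'"
    using obtain_subset_with_card_n[of 3 W] by metis
  then obtain h where h: "bij_betw h {0..<3::nat} W'"
    using ex_bij_betw_nat_finite by metis
  then have hW: "h i \<in> W" if "i < 3" for i
    using W' that by (auto simp: bij_betw_def)
  have hinj: "h i \<noteq> h j" if "i < 3" "j < 3" "i \<noteq> j" for i j
    using h that by (auto simp: bij_betw_def inj_on_def)
  have "K23_minor r V"
    unfolding K23_minor_def
  proof (rule exI[of _ "{a}"], rule exI[of _ "{b}"], rule exI[of _ "\<lambda>i. {h i}"],
      intro conjI allI impI)
    fix i :: nat assume i: "i < 3"
    have w: "h i \<in> V" "r (h i) a" "r (h i) b" using hW[OF i] W by auto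
    then show "{h i} \<subseteq> V" "{h i} \<inter> ({a} \<union> {b}) = {}" "touches r {a} {h i}" "touches r {b} {h i}"
      using r by (auto simp: touches_def irreflp_def sympD)
  qed (use ab hinj in \<open>auto simp: connected_in_singleton\<close>)
  with no show False by simp
qed

section \<open>Contractions, and lifting minors through them\<close>

definition quotient_rel :: "('a \<Rightarrow> 'a \<Rightarrow> bool) \<Rightarrow> 'a set \<Rightarrow> ('a \<Rightarrow> 'a) \<Rightarrow> 'a \<Rightarrow> 'a \<Rightarrow> bool" where
  "quotient_rel r V f u v \<longleftrightarrow> u \<noteq> v \<and> (\<exists>x\<in>V. \<exists>y\<in>V. f x = u \<and> f y = v \<and> r x y)"

lemma symp_quotient_rel: "symp r \<Longrightarrow> symp (quotient_rel r V f)"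
  unfolding symp_def quotient_rel_def by metis

lemma irreflp_quotient_rel: "irreflp (quotient_rel r V f)"
  unfolding irreflp_def quotient_rel_def by simp

text \<open>A cut of the preimage either splits some fibre, and then connectedness of that fibre
  supplies a crossing pair, or is a union of fibres, and then it projects to a cut of
  \<open>A\<close>, whose crossing pair lifts.\<close>

lemma connected_in_vimage:
  assumes fib: "\<And>u. u \<in> f ` V \<Longrightarrow> connected_in r {x\<in>V. f x = u}"
    and A: "connected_in (quotient_rel r V f) A" "A \<subseteq> f ` V"
  shows "connected_in r {x\<in>V. f x \<in> A}"
  unfolding connected_in_def
proof (intro conjI allI impI)
  show "{x \<in> V. f x \<in> A} \<noteq> {}" using A by (auto simp: connected_in_def)
next
  fix Y assume Y: "Y \<subseteq> {x \<in> V. f x \<in> A}" "Y \<noteq> {}" "Y \<noteq> {x \<in> V. f x \<in> A}"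
  show "\<exists>x\<in>Y. \<exists>y\<in>{x \<in> V. f x \<in> A} - Y. r x y"
  proof (cases "\<exists>x\<in>Y. \<exists>y\<in>V - Y. f y = f x")
    case True
    then obtain x y where xy: "x \<in> Y" "y \<in> V - Y" "f y = f x" by blast
    let ?F = "{z \<in> V. f z = f x}"
    have "connected_in r ?F" using fib[of "f x"] Y xy by blast
    moreover have "Y \<inter> ?F \<subseteq> ?F" "Y \<inter> ?F \<noteq> {}" "Y \<inter> ?F \<noteq> ?F" using Y xy by auto
    ultimately obtain u v where "u \<in> Y \<inter> ?F" "v \<in> ?F - Y \<inter> ?F" "r u v"
      by (rule connected_inE)
    then show ?thesis using Y xy by auto
  next
    case False
    have "f ` Y \<subseteq> A" "f ` Y \<noteq> {}" using Y by auto
    moreover have "f ` Y \<noteq> A" using False Y by fastforce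
    ultimately obtain u v where uv: "u \<in> f ` Y" "v \<in> A - f ` Y" "quotient_rel r V f u v"
      using connected_inE[OF A(1)] by metis
    then obtain x y where xy: "x \<in> V" "y \<in> V" "f x = u" "f y = v" "r x y"
      by (auto simp: quotient_rel_def)
    then have "x \<in> Y" "y \<notin> Y" using uv False by auto
    then show ?thesis using xy uv by auto
  qed
qed

text \<open>Preimages of branch sets are branch sets again: they are connected by
  \<open>connected_in_vimage\<close>, and each adjacency in the quotient comes from a related pair
  in \<open>V\<close>.\<close>

lemma K23_minor_quotient:
  assumes fib: "\<And>u. u \<in> f ` V \<Longrightarrow> connected_in r {x\<in>V. f x = u}"
    and m: "K23_minor (quotient_rel r V f) (f ` V)"
  shows "K23_minor r V"
proof -
  let ?q = "quotient_rel r V f" and ?l = "\<lambda>X. {x\<in>V. f x \<in> X}"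
  obtain A B C where m: "A \<subseteq> f ` V" "B \<subseteq> f ` V" "A \<inter> B = {}" "connected_in ?q A" "connected_in ?q B"
    and C: "\<And>i. i < (3::nat) \<Longrightarrow> C i \<subseteq> f ` V \<and> C i \<inter> (A \<union> B) = {} \<and> connected_in ?q (C i) \<and>
           touches ?q A (C i) \<and> touches ?q B (C i)"
    and dC: "\<And>i j. i < 3 \<Longrightarrow> j < 3 \<Longrightarrow> i \<noteq> j \<Longrightarrow> C i \<inter> C j = {}"
    using K23_minorE[OF m] by blast
  have conn: "connected_in r (?l X)" if "X \<subseteq> f ` V" "connected_in ?q X" for X
    using connected_in_vimage[OF fib] that by blast
  have tou: "touches r (?l X) (?l Y)" if "touches ?q X Y" for X Y
    using that unfolding touches_def quotient_rel_def by blast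
  show ?thesis
    unfolding K23_minor_def
    by (rule exI[of _ "?l A"], rule exI[of _ "?l B"], rule exI[of _ "\<lambda>i. ?l (C i)"])
      (use m C dC conn tou in \<open>auto; blast\<close>)
qed

text \<open>The representative \<open>t\<close> stays as the contracted vertex, so the contracted
  graph lives on the subset \<open>insert t (V - T)\<close> of the old vertex set and an induction
  on cardinality is possible.\<close>

definition collapse :: "'a set \<Rightarrow> 'a \<Rightarrow> 'a \<Rightarrow> 'a" where
  "collapse T t x = (if x \<in> T then t else x)"

lemma K23_minor_collapse:
  assumes "T \<subseteq> V" "t \<in> T" "connected_in r T"
    and "K23_minor (quotient_rel r V (collapse T t)) (insert t (V - T))"
  shows "K23_minor r V"
proof (rule K23_minor_quotient)
  have im: "collapse T t ` V = insert t (V - T)"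
    using assms by (auto simp: collapse_def)
  show "K23_minor (quotient_rel r V (collapse T t)) (collapse T t ` V)" using assms im by simp
  fix u assume "u \<in> collapse T t ` V"
  then have u: "u = t \<or> u \<in> V - T" using im by auto
  show "connected_in r {x \<in> V. collapse T t x = u}"
  proof (cases "u = t")
    case True
    then have "{x \<in> V. collapse T t x = u} = T" using assms by (auto simp: collapse_def)
    then show ?thesis using assms by simp
  next
    case False
    then have "{x \<in> V. collapse T t x = u} = {u}" using assms u by (auto simp: collapse_def)
    then show ?thesis by (simp add: connected_in_singleton)
  qed
qed

section \<open>The excess of a vertex set\<close>

definition degree_in :: "('a \<Rightarrow> 'a \<Rightarrow> bool) \<Rightarrow> 'a set \<Rightarrow> 'a \<Rightarrow> nat" where
  "degree_in r S v = card {u\<in>S. r v u}"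

text \<open>Edges inside \<open>S\<close> count twice in the first sum. Truncation lets a vertex of
  \<open>N\<close> without neighbours in \<open>S\<close> contribute 0, like one with a single
  neighbour.\<close>

definition excess :: "('a \<Rightarrow> 'a \<Rightarrow> bool) \<Rightarrow> 'a set \<Rightarrow> 'a set \<Rightarrow> nat" where
  "excess r S N = (\<Sum>u\<in>S. degree_in r S u) + (\<Sum>v\<in>N. degree_in r S v - 1)"

lemma degree_in_Un:
  assumes "finite S" "finite T" "S \<inter> T = {}"
  shows "degree_in r (S \<union> T) v = degree_in r S v + degree_in r T v"
proof -
  have "{u \<in> S \<union> T. r v u} = {u\<in>S. r v u} \<union> {u\<in>T. r v u}" by auto
  moreover have "{u\<in>S. r v u} \<inter> {u\<in>T. r v u} = {}" using assms by auto
  ultimately show ?thesis using assms by (simp add: degree_in_def card_Un_disjoint)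
qed

lemma degree_in_mono:
  assumes "finite S'" "\<And>u. u \<in> S \<Longrightarrow> r v u \<Longrightarrow> u \<in> S' \<and> r' v u"
  shows "degree_in r S v \<le> degree_in r' S' v"
  unfolding degree_in_def by (rule card_mono) (use assms in auto)

lemma sum_degree_in_swap:
  assumes "symp r" "finite S" "finite T"
  shows "(\<Sum>u\<in>S. degree_in r T u) = (\<Sum>w\<in>T. degree_in r S w)"
proof -
  have s: "degree_in r X v = (\<Sum>u\<in>X. if r v u then 1 else 0)" if "finite X" for X v
    using that by (simp add: degree_in_def sum.If_cases Int_def)
  have "r u w \<longleftrightarrow> r w u" for u w using assms by (auto dest: sympD)
  then have "(\<Sum>u\<in>S. degree_in r T u) = (\<Sum>u\<in>S. \<Sum>w\<in>T. if r w u then 1 else 0)"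
    unfolding s[OF assms(3)] by presburger
  also have "\<dots> = (\<Sum>w\<in>T. degree_in r S w)"
    using assms by (subst sum.swap) (simp add: s)
  finally show ?thesis .
qed

section \<open>Effect of a contraction on degrees and on the excess\<close>

lemma collapse_eq_outside: "t \<in> T \<Longrightarrow> w \<notin> T \<Longrightarrow> collapse T t x = w \<longleftrightarrow> x = w"
  and collapse_eq_inside: "t \<in> T \<Longrightarrow> collapse T t x = t \<longleftrightarrow> x \<in> T"
  by (auto simp: collapse_def)

lemma quotient_rel_collapse_outside:
  assumes "irreflp r" "t \<in> T" "u \<in> V - T" "w \<in> V - T"
  shows "quotient_rel r V (collapse T t) w u \<longleftrightarrow> r w u"
proof -
  have "u \<notin> T" "w \<notin> T" "u \<in> V" "w \<in> V" using assms by auto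
  moreover have "\<not> r u u" using assms by (simp add: irreflp_def)
  ultimately show ?thesis
    using assms(2) unfolding quotient_rel_def by (auto simp: collapse_eq_outside)
qed

lemma quotient_rel_collapse_inside:
  assumes "T \<subseteq> V" "t \<in> T" "w \<in> V - T"
  shows "quotient_rel r V (collapse T t) w t \<longleftrightarrow> (\<exists>z\<in>T. r w z)"
proof -
  have "w \<notin> T" "w \<in> V" "w \<noteq> t" using assms by auto
  then show ?thesis
    using assms(1,2) unfolding quotient_rel_def
    by (auto simp: collapse_eq_outside collapse_eq_inside)
qed

text \<open>The neighbours of \<open>w\<close> outside \<open>T\<close> survive, while those in
  \<open>T\<close> merge into the single neighbour \<open>t\<close>; the \<open>min\<close> records
  whether there are any.\<close>

lemma degree_in_collapse:
  assumes "finite S" "symp r" "irreflp r" "T \<subseteq> S" "t \<in> T" "S \<subseteq> V" "w \<in> V - T"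
  shows "degree_in (quotient_rel r V (collapse T t)) (insert t (S - T)) w =
     degree_in r (S - T) w + min 1 (degree_in r T w)"
proof -
  let ?q = "quotient_rel r V (collapse T t)"
  have q1: "?q w u \<longleftrightarrow> r w u" if "u \<in> S - T" for u
    by (rule quotient_rel_collapse_outside) (use that assms in auto)
  have q2: "?q w t \<longleftrightarrow> (\<exists>z\<in>T. r w z)"
    by (rule quotient_rel_collapse_inside) (use assms in auto)
  have t: "t \<notin> S - T" "finite (S - T)" using assms by auto
  have finT: "finite T" using assms finite_subset by blast
  have S: "{u\<in>S - T. ?q w u} = {u\<in>S - T. r w u}" using q1 by auto
  show ?thesis
  proof (cases "\<exists>z\<in>T. r w z")
    case True
    then have "{u\<in>insert t (S - T). ?q w u} = insert t {u\<in>S - T. r w u}"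
      using q1 q2 by auto
    moreover have "degree_in r T w \<ge> 1"
      using True finT by (auto simp: degree_in_def Suc_le_eq card_gt_0_iff)
    moreover have "card (insert t {u\<in>S - T. r w u}) = Suc (card {u\<in>S - T. r w u})"
      by (rule card_insert_disjoint) (use assms(1) t in auto)
    ultimately show ?thesis by (simp add: degree_in_def)
  next
    case False
    then have *: "{u\<in>insert t (S - T). ?q w u} = {u\<in>S - T. r w u}"
      using q1 q2 by auto
    have "{u\<in>T. r w u} = {}" using False by blast
    then have "degree_in r T w = 0" by (simp only: degree_in_def card.empty)
    with * show ?thesis by (simp add: degree_in_def)
  qed
qed

text \<open>Contraction loses the edges inside \<open>T\<close> and all but one of the edges from
  each outside vertex to \<open>T\<close>. For a vertex of \<open>S - T\<close> this loss appears at
  both ends, hence the factor 2; for a vertex of \<open>N\<close> it appears once.\<close>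

lemma excess_collapse:
  assumes fin: "finite S" "finite N" and r: "symp r" "irreflp r"
    and T: "T \<subseteq> S" "t \<in> T" and SN: "S \<inter> N = {}"
  shows "excess r S N \<le>
     excess (quotient_rel r (S \<union> N) (collapse T t)) (insert t (S - T)) N +
     (\<Sum>u\<in>T. degree_in r T u) + 2 * (\<Sum>w\<in>S - T. degree_in r T w - 1) +
     (\<Sum>w\<in>N. degree_in r T w - 1)"
proof -
  let ?V = "S \<union> N"
  let ?q = "quotient_rel r ?V (collapse T t)" and ?S' = "insert t (S - T)"
  let ?d = "degree_in r S" and ?e = "degree_in ?q ?S'" and ?\<tau> = "degree_in r T"
  have finT: "finite T" "finite (S - T)" and tS: "t \<notin> S - T"
    using fin T finite_subset by auto
  have d: "?d w = degree_in r (S - T) w + ?\<tau> w" for w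
    using degree_in_Un[of "S - T" T r w] finT T by (simp add: Un_absorb2 Diff_Int_distrib2)
  have e: "?e w = degree_in r (S - T) w + min 1 (?\<tau> w)" if "w \<in> ?V - T" for w
    using degree_in_collapse[OF fin(1) r T, of ?V w] that by simp
  have N: "(\<Sum>v\<in>N. ?d v - 1) \<le> (\<Sum>v\<in>N. ?e v - 1) + (\<Sum>w\<in>N. ?\<tau> w - 1)"
    unfolding sum.distrib[symmetric]
  proof (rule sum_mono)
    fix v assume "v \<in> N"
    then have "v \<in> ?V - T" using T SN by auto
    from e[OF this] d[of v] show "?d v - 1 \<le> ?e v - 1 + (?\<tau> v - 1)" by (simp add: min_def split: if_splits)
  qed
  \<comment> \<open>The contracted vertex is adjacent to exactly those vertices of
    \<open>S - T\<close> that had a neighbour in \<open>T\<close>.\<close>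
  have et: "?e t = (\<Sum>w\<in>S - T. min 1 (?\<tau> w))"
  proof -
    have "?q t w \<longleftrightarrow> ?\<tau> w > 0" if "w \<in> S - T" for w
    proof -
      have "?q t w \<longleftrightarrow> ?q w t" using symp_quotient_rel[OF r(1)] by (blast dest: sympD)
      also have "\<dots> \<longleftrightarrow> (\<exists>z\<in>T. r w z)"
        by (rule quotient_rel_collapse_inside) (use that T in auto)
      also have "\<dots> \<longleftrightarrow> ?\<tau> w > 0" using finT by (auto simp: degree_in_def card_gt_0_iff)
      finally show ?thesis .
    qed
    then have "{w \<in> ?S'. ?q t w} = {w \<in> S - T. ?\<tau> w > 0}"
      by (auto simp: quotient_rel_def)
    then have "?e t = card {w \<in> S - T. ?\<tau> w > 0}" by (simp add: degree_in_def)
    also have "\<dots> = (\<Sum>w\<in>S - T. if ?\<tau> w > 0 then 1 else 0)"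
      using finT by (simp add: sum.If_cases Int_def)
    also have "\<dots> = (\<Sum>w\<in>S - T. min 1 (?\<tau> w))"
      by (rule sum.cong) auto
    finally show ?thesis .
  qed
  have "(\<Sum>u\<in>S. ?d u) = (\<Sum>u\<in>S - T. ?d u) + (\<Sum>u\<in>T. ?d u)"
    using T fin by (simp add: sum.subset_diff)
  also have "(\<Sum>u\<in>T. ?d u) = (\<Sum>w\<in>S - T. ?\<tau> w) + (\<Sum>u\<in>T. ?\<tau> u)"
    unfolding d sum.distrib using sum_degree_in_swap[OF r(1) finT] by simp
  finally have "(\<Sum>u\<in>S. ?d u) = (\<Sum>w\<in>S - T. ?d w + ?\<tau> w) + (\<Sum>u\<in>T. ?\<tau> u)"
    by (simp add: sum.distrib)
  \<comment> \<open>Termwise the loss is twice \<open>?\<tau> w - 1\<close>: once in the degree of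
    \<open>w\<close>, and once in that of \<open>t\<close>, to which \<open>w\<close> now
    contributes \<open>min 1 (?\<tau> w)\<close>.\<close>
  moreover have "(\<Sum>w\<in>S - T. ?d w + ?\<tau> w) \<le> (\<Sum>w\<in>S - T. min 1 (?\<tau> w) + ?e w + 2 * (?\<tau> w - 1))"
  proof (rule sum_mono)
    fix v assume "v \<in> S - T"
    then have "v \<in> ?V - T" by auto
    from e[OF this] d[of v] show "?d v + ?\<tau> v \<le> min 1 (?\<tau> v) + ?e v + 2 * (?\<tau> v - 1)"
      by (simp add: min_def split: if_splits)
  qed
  moreover have "(\<Sum>w\<in>S - T. min 1 (?\<tau> w) + ?e w + 2 * (?\<tau> w - 1)) =
      (\<Sum>w\<in>?S'. ?e w) + 2 * (\<Sum>w\<in>S - T. ?\<tau> w - 1)"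
    using finT tS et by (simp add: sum.distrib sum_distrib_left)
  ultimately have "(\<Sum>u\<in>S. ?d u) \<le> (\<Sum>w\<in>?S'. ?e w) + 2 * (\<Sum>w\<in>S - T. ?\<tau> w - 1) + (\<Sum>u\<in>T. ?\<tau> u)"
    by linarith
  with N show ?thesis unfolding excess_def by linarith
qed

text \<open>The longest path inside the neighbourhood of \<open>x\<close> closes up to a wheel; a wheel with more than
  three spokes contains a \<open>K\<^bsub>2,3\<^esub>\<close> minor.\<close>
lemma clique4_if_edges_in_two_triangles:
  assumes fin: "finite S" and r: "symp r" "irreflp r" and S: "S \<subseteq> V" and no: "\<not> K23_minor r V"
    and edge: "x \<in> S" "y \<in> S" "r x y"
    and two: "\<And>x y. x \<in> S \<Longrightarrow> y \<in> S \<Longrightarrow> r x y \<Longrightarrow> card {w\<in>S. r w x \<and> r w y} \<ge> 2"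
  obtains Q where "Q \<subseteq> S" "card Q = 4" "\<forall>a\<in>Q. \<forall>b\<in>Q. a \<noteq> b \<longrightarrow> r a b"
proof -
  \<comment> \<open>\<open>P\<close> describes the paths inside the neighbourhood of
    \<open>x\<close>; their length is at most \<open>card S\<close>, so a longest one
    exists.\<close>
  define P where "P ps \<longleftrightarrow> ps \<noteq> [] \<and> distinct ps \<and> set ps \<subseteq> {w\<in>S. r w x} \<and> successively r ps" for ps
  have rs: "r a b \<Longrightarrow> r b a" for a b using r by (auto dest: sympD)
  have irr: "\<not> r a a" for a using r by (simp add: irreflp_def)
  have "P [y]" using edge rs by (auto simp: P_def)
  moreover have bd: "length ps \<le> card S" if "P ps" for ps
    using that distinct_card[of ps] card_mono[OF fin, of "set ps"] by (auto simp: P_def)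
  ultimately obtain ps where ps: "P ps" and max: "\<And>qs. P qs \<Longrightarrow> length qs \<le> length ps"
    using ex_has_greatest_nat[of P "[y]" length "Suc (card S)"] by (metis le_imp_less_Suc)
  obtain a ps' where a: "ps = a # ps'" using ps by (cases ps) (auto simp: P_def)
  have aS: "a \<in> S" "r a x" using ps by (auto simp: P_def a)
  have nbr: "b \<in> set ps'" if "b \<in> S" "r b x" "r b a" for b
  proof (rule ccontr)
    assume "b \<notin> set ps'"
    then have "P (b # ps)" using ps that irr by (auto simp: P_def a)
    from max[OF this] show False by simp
  qed
  have c2: "card {w\<in>S. r w x \<and> r w a} \<ge> 2"
    using two[of x a] aS edge rs by blast
  then obtain b0 where "b0 \<in> {w\<in>S. r w x \<and> r w a}"
    by (metis card.empty ex_in_conv not_numeral_le_zero)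
  then have "ps' \<noteq> []" using nbr by auto
  then obtain z rest where z: "ps' = z # rest" by (cases ps') auto
  have zS: "z \<in> S" "r z x" "r a z" using ps by (auto simp: P_def a z)
  \<comment> \<open>The edge from \<open>x\<close> to \<open>a\<close> lies in a second triangle,
    whose third vertex \<open>w\<close> comes after \<open>z\<close> on the path; \<open>M\<close>
    is the stretch strictly between them.\<close>
  have "\<not> {w\<in>S. r w x \<and> r w a} \<subseteq> {z}"
    using card_mono[of "{z}" "{w\<in>S. r w x \<and> r w a}"] c2 by auto
  then obtain w where w: "w \<in> S" "r w x" "r w a" "w \<noteq> z" by auto
  then have "w \<in> set rest" using nbr z by auto
  then obtain M L where M: "rest = M @ w # L" by (meson split_list)
  show ?thesis
  proof (cases "M = []")
    case True
    then have "r z w" using ps by (auto simp: P_def a z M)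
    then have "\<forall>c\<in>{x,a,z,w}. \<forall>b\<in>{x,a,z,w}. c \<noteq> b \<longrightarrow> r c b"
      using w zS aS rs by auto
    moreover have "card {x,a,z,w} = 4"
      using w zS aS irr by (auto simp: card_insert_if)
    ultimately show ?thesis using that[of "{x,a,z,w}"] w zS aS edge by auto
  next
    case False
    have suc: "successively r (z # M @ w # L)" and dis: "distinct (a # z # M @ w # L)"
      and sub: "set (a # z # M @ w # L) \<subseteq> {w\<in>S. r w x}"
      using ps False by (auto simp: P_def a z M)
    have sM: "successively r M" "r z (hd M)" "r (last M) w"
      using suc False by (auto simp: successively_append_iff successively_Cons)
    have hM: "hd M \<in> set M" "last M \<in> set M" using False by auto
    define C where "C = (\<lambda>i::nat. if i = 0 then {z} else if i = 1 then {w} else {x})"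
    \<comment> \<open>The vertex \<open>a\<close> and the stretch \<open>M\<close> form the side of
      two; \<open>z\<close>, \<open>w\<close> and the hub \<open>x\<close> are each adjacent to
      both.\<close>
    have "K23_minor r V"
      unfolding K23_minor_def
    proof (rule exI[of _ "{a}"], rule exI[of _ "set M"], rule exI[of _ C], intro conjI)
      show "{a} \<subseteq> V" "set M \<subseteq> V" using S sub by auto
      show "{a} \<inter> set M = {}" using dis by auto
      show "connected_in r {a}" by (rule connected_in_singleton)
      show "connected_in r (set M)" by (rule connected_in_successively) (use r sM False in auto)
      have xM: "x \<notin> set M" "x \<noteq> a" "x \<noteq> z" "x \<noteq> w" using sub irr by auto
      show "\<forall>i<3. \<forall>j<3. i \<noteq> j \<longrightarrow> C i \<inter> C j = {}"
        using xM w by (auto simp: C_def)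
      have "touches r {a} (C i)" for i
        using aS zS w rs by (auto simp: touches_def C_def)
      moreover have "touches r (set M) (C i)" for i
        using sM hM sub rs by (fastforce simp: touches_def C_def)
      moreover have "C i \<subseteq> V" "C i \<inter> ({a} \<union> set M) = {}" "connected_in r (C i)" for i
        using S zS w edge xM dis by (auto simp: C_def connected_in_singleton)
      ultimately show "\<forall>i<3. C i \<subseteq> V \<and> C i \<inter> ({a} \<union> set M) = {} \<and> connected_in r (C i) \<and>
           touches r {a} (C i) \<and> touches r (set M) (C i)" by blast
    qed
    with no show ?thesis by simp
  qed
qed

text \<open>If \<open>w\<close> had two neighbours \<open>a\<close>, \<open>b\<close> in the clique,
  then \<open>w\<close> and the two remaining clique vertices would be three common neighbours of
  \<open>a\<close> and \<open>b\<close>.\<close>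

lemma degree_in_clique4_le_1:
  assumes r: "irreflp r" "symp r" and no: "\<not> K23_minor r V"
    and K: "K \<subseteq> V" "card K = 4" "\<forall>a\<in>K. \<forall>b\<in>K. a \<noteq> b \<longrightarrow> r a b" and w: "w \<in> V - K"
    and T: "T \<subseteq> K"
  shows "degree_in r T w \<le> 1"
proof (rule ccontr)
  have fK: "finite K" using K(2) by (metis card.infinite zero_neq_numeral)
  then have "finite {u \<in> T. r w u}" using T finite_subset by fastforce
  moreover assume "\<not> degree_in r T w \<le> 1"
  ultimately obtain a b where ab: "a \<in> T" "b \<in> T" "a \<noteq> b" "r w a" "r w b"
    using card_le_Suc0_iff_eq[of "{u \<in> T. r w u}"] by (auto simp: degree_in_def)
  have "card (insert w (K - {a, b})) \<le> 2"
    by (rule card_common_neighbors_le_2[OF r no, of a b]) (use K T w ab fK in auto)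
  moreover have "card (insert w (K - {a, b})) = Suc (card (K - {a, b}))"
    by (rule card_insert_disjoint) (use w fK in auto)
  moreover have "card (K - {a, b}) = 2"
    using ab T K by (subst card_Diff_subset) auto
  ultimately show False by simp
qed

lemma sum_degree_in_clique:
  assumes "irreflp r" "finite T" "\<forall>a\<in>T. \<forall>b\<in>T. a \<noteq> b \<longrightarrow> r a b"
  shows "(\<Sum>u\<in>T. degree_in r T u) = card T * (card T - 1)"
proof -
  have "degree_in r T u = card T - 1" if "u \<in> T" for u
  proof -
    have "{w\<in>T. r u w} = T - {u}" using assms that by (auto simp: irreflp_def)
    then show ?thesis using that assms by (simp add: degree_in_def)
  qed
  then show ?thesis by simp
qed

text \<open>The bound \<open>5 |S| - 6\<close> is attained by a triangulated polygon on \<open>S\<close> with one further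
  vertex attached to each of its outer edges.\<close>
lemma excess_le:
  assumes "finite V" "symp r" "irreflp r" "\<not> K23_minor r V" "S \<subseteq> V" "2 \<le> card S"
  shows "excess r S (V - S) + 6 \<le> 5 * card S"
  using assms
\<comment> \<open>Moving a vertex into \<open>S\<close> keeps \<open>V\<close> and shrinks
  \<open>V - S\<close>; a contraction shrinks \<open>V\<close> and does not enlarge
  \<open>V - S\<close>. The sum of both sizes decreases either way.\<close>
proof (induction "card V + card (V - S)" arbitrary: r V S rule: less_induct)
  case less
  note IH = less(1)
  note fin = less(2) and r = less(3,4) and no = less(5) and S = less(6) and S2 = less(7)
  let ?N = "V - S"
  have fS: "finite S" "finite ?N" using fin S finite_subset by auto
  have irr: "\<not> r x x" and sy: "r x y \<Longrightarrow> r y x" for x y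
    using r by (auto simp: irreflp_def dest: sympD)
  \<comment> \<open>Here \<open>e\<close> is the excess after contracting \<open>T\<close>. The
    induction hypothesis bounds it for the \<open>card S - card T + 1\<close> remaining vertices of
    \<open>S\<close>, except when \<open>T\<close> is all of \<open>S\<close>: then one vertex is
    left and \<open>e = 0\<close>.\<close>
  have collapse: "(\<exists>e. excess r S ?N \<le> e + (\<Sum>u\<in>T. degree_in r T u) +
      2 * (\<Sum>w\<in>S - T. degree_in r T w - 1) + (\<Sum>w\<in>?N. degree_in r T w - 1) \<and>
      (e + 6 + 5 * (card T - 1) \<le> 5 * card S \<or> e = 0 \<and> card S = card T))"
    if T: "T \<subseteq> S" "connected_in r T" "card T \<ge> 2" for T
  proof -
    obtain t where t: "t \<in> T" using T(3) by fastforce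
    have fT: "finite T" using T fS finite_subset by auto
    let ?q = "quotient_rel r V (collapse T t)"
    let ?V' = "insert t (V - T)" and ?S' = "insert t (S - T)"
    have cTS: "card T \<le> card S" by (rule card_mono) (use fS T in auto)
    have cS': "card ?S' = card S - card T + 1"
      using t T fS fT by (subst card_insert_disjoint) (auto simp: card_Diff_subset)
    have cV': "card ?V' = card V - card T + 1"
      using t T fin fT S by (subst card_insert_disjoint) (auto simp: card_Diff_subset)
    have "card T \<le> card V" by (rule card_mono) (use fin T S in auto)
    then have lt: "card ?V' < card V" using cV' T(3) by linarith
    have N': "?V' - ?S' = ?N" using t T S by auto
    have q: "symp ?q" "irreflp ?q" by (rule symp_quotient_rel[OF r(1)], rule irreflp_quotient_rel)
    have noq: "\<not> K23_minor ?q ?V'"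
      using K23_minor_collapse[of T V t r] T S t no by blast
    have "S \<union> ?N = V" using S by auto
    then have ex: "excess r S ?N \<le> excess ?q ?S' ?N + (\<Sum>u\<in>T. degree_in r T u) +
      2 * (\<Sum>w\<in>S - T. degree_in r T w - 1) + (\<Sum>w\<in>?N. degree_in r T w - 1)"
      using excess_collapse[OF fS r T(1) t] by (simp add: Int_Diff)
    show ?thesis
    proof (cases "card S = card T")
      case True
      then have ST: "S = T" using T fS by (metis card_subset_eq)
      have "degree_in ?q {t} w \<le> 1" for w
        unfolding degree_in_def by (rule order_trans[OF card_mono[of "{t}"]]) auto
      moreover have "degree_in ?q {t} t = 0" by (simp add: degree_in_def quotient_rel_def)
      ultimately have "excess ?q ?S' ?N = 0" by (simp add: ST excess_def)
      then show ?thesis using ex True by blast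
    next
      case False
      then have "2 \<le> card ?S'" using cS' cTS by linarith
      then have "excess ?q ?S' (?V' - ?S') + 6 \<le> 5 * card ?S'"
        by (intro IH) (use lt N' q noq fin S in auto)
      then have "excess ?q ?S' ?N + 6 + 5 * (card T - 1) \<le> 5 * card S"
        unfolding N' using cS' cTS T(3) by linarith
      then show ?thesis using ex by blast
    qed
  qed
  consider
    (many) v where "v \<in> ?N" "degree_in r S v \<ge> 4"
    | (nonadj) v u w where "v \<in> ?N" "degree_in r S v \<le> 3" "u \<in> S" "w \<in> S" "u \<noteq> w" "r v u" "r v w" "\<not> r u w"
    | (clique) "\<forall>v\<in>?N. \<forall>a\<in>{s\<in>S. r v s}. \<forall>b\<in>{s\<in>S. r v s}. a \<noteq> b \<longrightarrow> r a b"
  proof (cases "\<exists>v\<in>?N. degree_in r S v \<ge> 4")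
    case False
    then have "degree_in r S v \<le> 3" if "v \<in> ?N" for v using that by force
    then show ?thesis using nonadj clique by blast
  qed (use many in blast)
  then show ?case
  proof cases
    case many
    let ?S' = "insert v S"
    have N: "V - ?S' = ?N - {v}" by auto
    have cN: "card (V - ?S') < card ?N" unfolding N by (rule card_Diff1_less) (use many fS in auto)
    have "excess r ?S' (V - ?S') + 6 \<le> 5 * card ?S'"
      by (rule IH) (use cN fin r no S S2 many fS in auto)
    then have IH': "excess r ?S' (V - ?S') + 6 \<le> 5 * card S + 5" using many fS by simp
    have dv: "degree_in r {v} v = 0" using irr by (simp add: degree_in_def)
    have d: "degree_in r ?S' u = degree_in r S u + degree_in r {v} u" for u
      using degree_in_Un[of S "{v}" r u] fS many by simp
    have "(\<Sum>u\<in>S. degree_in r {v} u) = degree_in r S v"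
      using sum_degree_in_swap[OF r(1) fS(1), of "{v}"] by simp
    \<comment> \<open>The degree d of \<open>v\<close> enters the first sum twice, while the second
      sum loses d - 1: a gain of d + 1, which is at least 5, as much as the bound grows.\<close>
    then have 1: "(\<Sum>u\<in>?S'. degree_in r ?S' u) = 2 * degree_in r S v + (\<Sum>u\<in>S. degree_in r S u)"
      using many fS by (simp add: d dv sum.distrib)
    have "(\<Sum>v\<in>?N. degree_in r S v - 1) = degree_in r S v - 1 + (\<Sum>v\<in>V - ?S'. degree_in r S v - 1)"
      unfolding N by (rule sum.remove) (use many fS in auto)
    moreover have "(\<Sum>v\<in>V - ?S'. degree_in r S v - 1) \<le> (\<Sum>v\<in>V - ?S'. degree_in r ?S' v - 1)"
      by (rule sum_mono) (simp add: d)
    ultimately have "excess r S ?N + 5 \<le> excess r ?S' (V - ?S')"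
      unfolding excess_def using 1 many(2) by linarith
    then show ?thesis using IH' by linarith
  next
    case nonadj
    \<comment> \<open>Contracting \<open>v\<close> into \<open>u\<close> creates the edge from
      \<open>u\<close> to \<open>w\<close>, which adds 2 to the first sum; this makes up for the
      lost contribution of \<open>v\<close>, which is at most 2.\<close>
    let ?T = "{u, v}"
    let ?q = "quotient_rel r V (collapse ?T u)" and ?V' = "V - {v}"
    have uv: "u \<noteq> v" "w \<noteq> v" "v \<in> V" "v \<notin> S" using nonadj by auto
    have V': "insert u (V - ?T) = ?V'" using nonadj S by auto
    have q: "symp ?q" "irreflp ?q" by (rule symp_quotient_rel[OF r(1)], rule irreflp_quotient_rel)
    have noq: "\<not> K23_minor ?q ?V'"
      using K23_minor_collapse[of ?T V u r] nonadj uv S no V' sy connected_in_edge[OF r(1), of u v] by auto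
    have qr: "?q x y" if "x \<in> ?V'" "y \<in> ?V'" "r x y" for x y
    proof -
      have "x \<noteq> y" using that(3) irr by metis
      moreover have "collapse ?T u x = x" "collapse ?T u y = y" using that by (auto simp: collapse_def)
      ultimately show ?thesis unfolding quotient_rel_def using that by blast
    qed
    have quw: "?q u w"
    proof -
      have "collapse ?T u v = u" "collapse ?T u w = w" "w \<in> V" using nonadj uv S by (auto simp: collapse_def)
      then show ?thesis unfolding quotient_rel_def using nonadj(5,7) uv(3) by blast
    qed
    then have qwu: "?q w u" using q by (auto dest: sympD)
    have N': "?V' - S = ?N - {v}" by auto
    have cV: "card ?V' < card V" by (rule card_Diff1_less) (use fin uv in auto)
    have cN: "card (?V' - S) \<le> card ?N" by (rule card_mono) (use fin in auto)
    have IH': "excess ?q S (?V' - S) + 6 \<le> 5 * card S"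
      by (rule IH) (use cV cN fin q noq S S2 uv in auto)
    have SV: "x \<in> ?V'" if "x \<in> S" for x using that S uv by auto
    have dm: "degree_in r S x \<le> degree_in ?q S x" if "x \<in> ?V'" for x
      by (rule degree_in_mono) (use fS that qr SV in auto)
    have dadd: "degree_in r S x + 1 \<le> degree_in ?q S x"
      if "x \<in> S" "y \<in> S" "\<not> r x y" "?q x y" for x y
    proof -
      have "card (insert y {z\<in>S. r x z}) \<le> card {z\<in>S. ?q x z}"
        by (rule card_mono) (use fS that qr SV in auto)
      then show ?thesis using that fS by (simp add: degree_in_def)
    qed
    have "(\<Sum>x\<in>S. degree_in r S x + ((if x = u then 1 else 0) + (if x = w then 1 else 0)))
        \<le> (\<Sum>x\<in>S. degree_in ?q S x)"
    proof (rule sum_mono)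
      fix x assume "x \<in> S"
      then show "degree_in r S x + ((if x = u then 1 else 0) + (if x = w then 1 else 0)) \<le> degree_in ?q S x"
        using dm[OF SV] dadd[of u w] dadd[of w u] nonadj quw qwu sy[of w u] by auto
    qed
    then have 1: "(\<Sum>x\<in>S. degree_in r S x) + 2 \<le> (\<Sum>x\<in>S. degree_in ?q S x)"
      using nonadj fS by (simp add: sum.distrib)
    have "(\<Sum>x\<in>?N. degree_in r S x - 1) = degree_in r S v - 1 + (\<Sum>x\<in>?N - {v}. degree_in r S x - 1)"
      by (rule sum.remove) (use nonadj fS in auto)
    moreover have "(\<Sum>x\<in>?N - {v}. degree_in r S x - 1) \<le> (\<Sum>x\<in>?N - {v}. degree_in ?q S x - 1)"
      by (rule sum_mono) (use dm in \<open>auto intro!: diff_le_mono\<close>)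
    ultimately have "excess r S ?N \<le> excess ?q S (?V' - S)"
      unfolding excess_def N' using 1 nonadj(2) by linarith
    then show ?thesis using IH' by linarith
  next
    case clique
    show ?thesis
    proof (cases "\<exists>x\<in>S. \<exists>y\<in>S. r x y")
      case False
      then have "degree_in r S x = 0" if "x \<in> S" for x
      proof -
        have "{u\<in>S. r x u} = {}" using that False by blast
        then show ?thesis by (simp only: degree_in_def card.empty)
      qed
      \<comment> \<open>Two neighbours of \<open>v\<close> in \<open>S\<close> would be adjacent,
        but \<open>S\<close> spans no edge here; so the excess vanishes.\<close>
      moreover have "degree_in r S v \<le> 1" if "v \<in> ?N" for v
        unfolding degree_in_def using clique False that fS
        by (simp add: card_le_Suc0_iff_eq)
      ultimately have "excess r S ?N = 0" by (simp add: excess_def)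
      then show ?thesis using S2 by simp
    next
      case True
      show ?thesis
      proof (cases "\<exists>x\<in>S. \<exists>y\<in>S. r x y \<and> card {w\<in>S. r w x \<and> r w y} \<le> 1")
        case True
        then obtain x y where xy: "x \<in> S" "y \<in> S" "r x y" and q1: "card {w\<in>S. r w x \<and> r w y} \<le> 1"
          by blast
        let ?T = "{x, y}" and ?Q = "{w\<in>S. r w x \<and> r w y}" and ?P = "{w\<in>?N. r w x \<and> r w y}"
        have ne: "x \<noteq> y" using xy irr by auto
        have \<tau>: "degree_in r ?T w - 1 = (if r w x \<and> r w y then 1 else 0)" for w
        proof -
          have "{u \<in> ?T. r w u} = (if r w x then {x} else {}) \<union> (if r w y then {y} else {})" by auto
          then show ?thesis using ne by (simp add: degree_in_def)
        qed
        have "(\<Sum>w\<in>S - ?T. degree_in r ?T w - 1) = card {w\<in>S - ?T. r w x \<and> r w y}"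
          unfolding \<tau> using fS by (simp add: sum.If_cases Int_def)
        also have "{w\<in>S - ?T. r w x \<and> r w y} = ?Q" using irr by auto
        finally have 2: "(\<Sum>w\<in>S - ?T. degree_in r ?T w - 1) = card ?Q" .
        have 1: "(\<Sum>w\<in>?N. degree_in r ?T w - 1) = card ?P"
          unfolding \<tau> using fS by (simp add: sum.If_cases Int_def)
        have "card (?Q \<union> ?P) \<le> 2"
          by (rule card_common_neighbors_le_2[OF r(2,1) no, of x y]) (use xy ne S fS in auto)
        moreover have "card (?Q \<union> ?P) = card ?Q + card ?P"
          by (rule card_Un_disjoint) (use fS in auto)
        ultimately have 3: "card ?Q + card ?P \<le> 2" by simp
        have 4: "(\<Sum>u\<in>?T. degree_in r ?T u) = 2"
          using sum_degree_in_clique[OF r(2), of ?T] ne xy sy by auto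
        \<comment> \<open>The degenerate alternative \<open>card S = 2\<close> tolerates a cost of
          only 4; it cannot occur together with a triangle inside \<open>S\<close>.\<close>
        have 5: "card S \<ge> 3" if "card ?Q = 1"
        proof -
          from that obtain z where "?Q = {z}" by (rule card_1_singletonE)
          then have "z \<in> ?Q" by (simp only: singletonI)
          then have z: "z \<in> S" "z \<noteq> x" "z \<noteq> y" using irr by blast+
          then have "card {x,y,z} \<le> card S" using xy by (intro card_mono fS) auto
          moreover have "card {x,y,z} = 3" using ne z by simp
          ultimately show ?thesis by simp
        qed
        have "connected_in r ?T" using connected_in_edge[OF r(1) xy(3)] .
        then obtain e where e: "excess r S ?N \<le> e + 2 + 2 * card ?Q + card ?P"
          "e + 11 \<le> 5 * card S \<or> e = 0 \<and> card S = 2"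
          using collapse[of ?T] xy ne unfolding 1 2 4 by auto
        have "card ?Q = 0 \<or> card ?Q = 1" using q1 by linarith
        then show ?thesis
        proof
          assume "card ?Q = 0"
          then show ?thesis using e 3 by linarith
        next
          assume "card ?Q = 1"
          then show ?thesis using e 3 5 by linarith
        qed
      next
        case F: False
        obtain x y where xy: "x \<in> S" "y \<in> S" "r x y" using True by blast
        have "card {w\<in>S. r w x \<and> r w y} \<ge> 2" if "x \<in> S" "y \<in> S" "r x y" for x y
        proof -
          have "\<not> card {w\<in>S. r w x \<and> r w y} \<le> 1" using F that by blast
          then show ?thesis by linarith
        qed
        then obtain Q where Q: "Q \<subseteq> S" "card Q = 4" "\<forall>a\<in>Q. \<forall>b\<in>Q. a \<noteq> b \<longrightarrow> r a b"
          using clique4_if_edges_in_two_triangles[OF fS(1) r S no xy] by blast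
        have fQ: "finite Q" using Q fS finite_subset by auto
        have cQ: "connected_in r Q" by (rule connected_in_clique) (use Q in auto)
        have \<tau>: "degree_in r Q w - 1 = 0" if "w \<in> V - Q" for w
          using degree_in_clique4_le_1[OF r(2,1) no _ Q(2,3), of w Q] that Q S by auto
        have "?N \<subseteq> V - Q" "S - Q \<subseteq> V - Q" using S Q by auto
        then have 1: "(\<Sum>w\<in>?N. degree_in r Q w - 1) = 0" "(\<Sum>w\<in>S - Q. degree_in r Q w - 1) = 0"
          using \<tau> by (blast intro: sum.neutral)+
        \<comment> \<open>Only the six edges of the clique are lost, at a cost of 12, while three
          vertices fewer lower the bound by 15. If \<open>S\<close> is the clique itself, 12 is
          below 5 * 4 - 6.\<close>
        have 3: "(\<Sum>u\<in>Q. degree_in r Q u) = 12"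
          using sum_degree_in_clique[OF r(2) fQ Q(3)] Q(2) by simp
        show ?thesis using collapse[OF Q(1) cQ] Q(2) 1 3 S2 by auto
      qed
    qed
  qed
qed

section \<open>Theta curves\<close>

text \<open>An \<open>arc\<close> is never constant, so the one-point case is added: it occurs when
  a leg of a tripod or a connecting piece degenerates to a point.\<close>

definition arc_between :: "complex \<Rightarrow> complex \<Rightarrow> complex set \<Rightarrow> bool" where
  "arc_between a b P \<longleftrightarrow> a = b \<and> P = {a} \<or>
     (\<exists>g. arc g \<and> pathstart g = a \<and> pathfinish g = b \<and> path_image g = P)"

lemma arc_between_refl: "arc_between a a {a}"
  by (simp add: arc_between_def)

lemma arc_between_arc: "arc g \<Longrightarrow> arc_between (pathstart g) (pathfinish g) (path_image g)"
  unfolding arc_between_def by blast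

lemma arc_between_sym: "arc_between a b P \<Longrightarrow> arc_between b a P"
  unfolding arc_between_def
  by (metis arc_reversepath path_image_reversepath pathfinish_reversepath pathstart_reversepath)

lemma arc_between_ends: "arc_between a b P \<Longrightarrow> a \<in> P \<and> b \<in> P"
  unfolding arc_between_def by auto

lemma compact_arc_between: "arc_between a b P \<Longrightarrow> compact P"
  unfolding arc_between_def by (auto simp: compact_arc_image)

lemma arc_between_join:
  assumes P: "arc_between a b P" and Q: "arc_between b c Q" and PQ: "P \<inter> Q \<subseteq> {b}"
  shows "arc_between a c (P \<union> Q)"
proof (cases "a = b \<and> P = {a} \<or> b = c \<and> Q = {b}")
  case True
  then show ?thesis using P Q arc_between_ends[OF P] arc_between_ends[OF Q]
    by (auto simp: insert_absorb)
next
  case False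
  then obtain g h where "arc g" "pathstart g = a" "pathfinish g = b" "path_image g = P"
    "arc h" "pathstart h = b" "pathfinish h = c" "path_image h = Q"
    using P Q unfolding arc_between_def by blast
  then show ?thesis
    unfolding arc_between_def using PQ
    by (intro disjI2 exI[of _ "g +++ h"]) (simp add: arc_join path_image_join)
qed

lemma arc_between_subarc:
  assumes "arc g" "0 \<le> s" "s \<le> t" "t \<le> 1"
  shows "arc_between (g s) (g t) (g ` {s..t})"
proof (cases "s = t")
  case True
  then show ?thesis by (simp add: arc_between_refl)
next
  case False
  then have "arc (subpath s t g)" using assms by (intro arc_subpath_arc) auto
  then show ?thesis
    using arc_between_arc[of "subpath s t g"] assms
    by (simp add: path_image_subpath pathstart_subpath pathfinish_subpath)
qed

lemma arc_between_exists:
  assumes "path_connected D" "a \<in> D" "b \<in> D"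
  obtains P where "P \<subseteq> D" "arc_between a b P"
proof (cases "a = b")
  case True
  then show ?thesis using that[of "{a}"] assms arc_between_refl by simp
next
  case False
  then obtain g where "arc g" "path_image g \<subseteq> D" "pathstart g = a" "pathfinish g = b"
    using assms path_connected_arcwise[of D] by blast
  then show ?thesis using that[of "path_image g"] arc_between_arc by blast
qed

text \<open>Stop at the least parameter whose point lies in \<open>K\<close>; it exists since the
  set of these parameters is compact and contains 1.\<close>

lemma arc_between_first_hit:
  assumes P: "arc_between a b P" and K: "closed K" "b \<in> K"
  obtains k Q where "Q \<subseteq> P" "arc_between a k Q" "Q \<inter> K = {k}"
proof (cases "a \<in> K")
  case True
  then show ?thesis using that[of "{a}" a] arc_between_ends[OF P] arc_between_refl by auto
next
  case False
  then obtain g where g: "arc g" "pathstart g = a" "pathfinish g = b" "path_image g = P"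
    using P K unfolding arc_between_def by blast
  let ?Z = "{0..1} \<inter> g -` K"
  have "continuous_on {0..1} g" using g(1) by (simp add: arc_def path_def)
  then have "compact ?Z"
    using K by (simp add: compact_eq_bounded_closed continuous_closed_preimage bounded_Int)
  moreover have "1 \<in> ?Z" using g(3) K by (simp add: pathfinish_def)
  ultimately obtain t where t: "t \<in> ?Z" "\<And>s. s \<in> ?Z \<Longrightarrow> t \<le> s"
    using compact_attains_inf[of ?Z] by blast
  have "g ` {0..t} \<inter> K = {g t}"
  proof (intro equalityI subsetI)
    fix x assume "x \<in> g ` {0..t} \<inter> K"
    then obtain s where s: "0 \<le> s" "s \<le> t" "x = g s" "g s \<in> K" by auto
    then have "s \<in> ?Z" using t(1) by auto
    then have "s = t" using t(2) s by force
    then show "x \<in> {g t}" using s by simp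
  qed (use t in auto)
  moreover have "g ` {0..t} \<subseteq> P" using g(4) t(1) by (auto simp: path_image_def)
  moreover have "arc_between a (g t) (g ` {0..t})"
    using arc_between_subarc[OF g(1), of 0 t] t(1) g(2) by (simp add: pathstart_def)
  ultimately show ?thesis using that by blast
qed

lemma arc_between_split:
  assumes P: "arc_between a b P" and c: "c \<in> P"
  obtains Q R where "arc_between a c Q" "arc_between c b R" "Q \<union> R = P" "Q \<inter> R = {c}"
proof (cases "P = {a}")
  case True
  then have "b = a" "c = a" using c arc_between_ends[OF P] by auto
  then show ?thesis using that[of "{a}" "{a}"] True arc_between_refl by simp
next
  case False
  then obtain g where g: "arc g" "pathstart g = a" "pathfinish g = b" "path_image g = P"
    using P unfolding arc_between_def by blast
  then obtain t where t: "0 \<le> t" "t \<le> 1" "c = g t" using c by (auto simp: path_image_def)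
  show ?thesis
  proof (rule that[of "g ` {0..t}" "g ` {t..1}"])
    show "arc_between a c (g ` {0..t})" "arc_between c b (g ` {t..1})"
      using arc_between_subarc[OF g(1), of 0 t] arc_between_subarc[OF g(1), of t 1] t g
      by (auto simp: pathstart_def pathfinish_def)
    have "{0..t} \<union> {t..1} = {0..1}" using t by auto
    then show "g ` {0..t} \<union> g ` {t..1} = P"
      using g(4) by (simp add: path_image_def image_Un[symmetric])
    have "g ` {0..t} \<inter> g ` {t..1} = g ` ({0..t} \<inter> {t..1})"
      using g(1) t by (intro inj_on_image_Int[symmetric, of g "{0..1}"]) (auto simp: arc_def)
    also have "{0..t} \<inter> {t..1} = {t}" using t by auto
    finally show "g ` {0..t} \<inter> g ` {t..1} = {c}" using t by simp
  qed
qed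

text \<open>Join \<open>x 0\<close> and \<open>x 1\<close> by an arc and follow an arc from
  \<open>x 2\<close> until it first hits this one. The hitting point is the centre \<open>a\<close>,
  which splits the first arc into the other two legs. The given points may coincide, and legs may be
  single points.\<close>

lemma tripod:
  assumes D: "path_connected D" "\<And>i. i < 3 \<Longrightarrow> x i \<in> D"
  obtains a R where "a \<in> D" "\<And>i. i < (3::nat) \<Longrightarrow> arc_between (x i) a (R i) \<and> R i \<subseteq> D"
    "\<And>i j. i < 3 \<Longrightarrow> j < 3 \<Longrightarrow> i \<noteq> j \<Longrightarrow> R i \<inter> R j = {a}"
proof -
  have x: "x 0 \<in> D" "x 1 \<in> D" "x 2 \<in> D" using D(2) by simp_all
  obtain P where P: "P \<subseteq> D" "arc_between (x 0) (x 1) P" using arc_between_exists D(1) x by metis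
  obtain Q where Q: "Q \<subseteq> D" "arc_between (x 2) (x 0) Q" using arc_between_exists D(1) x by metis
  have "closed P" using P compact_arc_between compact_imp_closed by blast
  then obtain a R2 where a: "R2 \<subseteq> Q" "arc_between (x 2) a R2" "R2 \<inter> P = {a}"
    using arc_between_first_hit[OF Q(2)] arc_between_ends[OF P(2)] by metis
  obtain R0 R1 where R: "arc_between (x 0) a R0" "arc_between a (x 1) R1" "R0 \<union> R1 = P" "R0 \<inter> R1 = {a}"
    using arc_between_split[OF P(2), of a] a by blast
  note R1 = arc_between_sym[OF R(2)]
  have I: "R0 \<inter> R2 = {a}" "R1 \<inter> R2 = {a}" "a \<in> D" using R a P arc_between_ends[OF R(1)] arc_between_ends[OF R1] by blast+
  define F where "F = (\<lambda>i::nat. if i = 0 then R0 else if i = 1 then R1 else R2)"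
  have cases3: "i = 0 \<or> i = 1 \<or> i = 2" if "i < 3" for i :: nat using that by auto
  show ?thesis
  proof (rule that[of a F])
    show "arc_between (x i) a (F i) \<and> F i \<subseteq> D" if "i < 3" for i
      using cases3[OF that] R R1 a P Q by (auto simp: F_def)
    show "F i \<inter> F j = {a}" if "i < 3" "j < 3" "i \<noteq> j" for i j
      using cases3[OF that(1)] cases3[OF that(2)] that(3) R(4) I by (auto simp: F_def)
  qed (fact I)
qed

lemma arc_between_loop:
  assumes "a \<noteq> b" "arc_between a b P" "arc_between a b Q" "P \<inter> Q = {a, b}"
  obtains c where "simple_path c" "pathfinish c = pathstart c" "path_image c = P \<union> Q"
proof -
  obtain g h where "arc g" "pathstart g = a" "pathfinish g = b" "path_image g = P"
    "arc h" "pathstart h = b" "pathfinish h = a" "path_image h = Q"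
    using assms arc_between_sym[OF assms(3)] unfolding arc_between_def by blast
  then show ?thesis
    using that[of "g +++ h"] assms(4)
    by (auto simp: simple_path_join_loop path_image_join)
qed

section \<open>Jordan curves made of two arcs, and the three arcs of a theta curve\<close>

lemma Jordan_arcs:
  assumes "a \<noteq> b" "arc_between a b P" "arc_between a b Q" "P \<inter> Q = {a, b}"
  shows "inside (P \<union> Q) \<noteq> {}" "open (inside (P \<union> Q))" "connected (inside (P \<union> Q))"
    "open (outside (P \<union> Q))" "connected (outside (P \<union> Q))" "frontier (inside (P \<union> Q)) = P \<union> Q"
  using arc_between_loop[OF assms] Jordan_inside_outside by metis+

lemma connected_inside_or_outside:
  assumes "a \<noteq> b" "arc_between a b P" "arc_between a b Q" "P \<inter> Q = {a, b}"
    and "connected X" "X \<inter> (P \<union> Q) = {}"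
  shows "X \<subseteq> inside (P \<union> Q) \<or> X \<subseteq> outside (P \<union> Q)"
proof -
  have "X \<subseteq> inside (P \<union> Q) \<union> outside (P \<union> Q)" using assms(6) inside_Un_outside by blast
  then show ?thesis
    using connectedD[OF assms(5) Jordan_arcs(2,4)[OF assms(1-4)]] inside_Int_outside[of "P \<union> Q"]
    by blast
qed

lemma connected_arc_between_interior:
  assumes "arc_between a b P"
  shows "connected (P - {a, b})"
  using assms connected_simple_path_endless arc_imp_simple_path
  unfolding arc_between_def by auto

lemma arc_between_interior_nonempty:
  assumes "a \<noteq> b" "arc_between a b P"
  shows "P - {a, b} \<noteq> {}"
proof
  assume "P - {a, b} = {}"
  then have "P = {a, b}" using arc_between_ends[OF assms(2)] by auto
  moreover have "connected P" using assms connected_arc_image unfolding arc_between_def by blast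
  ultimately have "\<exists>x. {a, b} = {x}" using connected_finite_iff_sing[of "{a, b}"] by auto
  then show False using assms(1) by (auto simp: doubleton_eq_iff)
qed

text \<open>Each of the two insides is connected and misses the other closed curve, so it lies
  wholly inside or wholly outside it. If they were not apart they would coincide, and so would their
  frontiers \<open>P1 \<union> P3\<close> and \<open>P2 \<union> P3\<close>.\<close>

lemma theta_insides_apart:
  assumes ab: "a \<noteq> b" and P: "arc_between a b P1" "arc_between a b P2" "arc_between a b P3"
    and I: "P1 \<inter> P2 = {a, b}" "P1 \<inter> P3 = {a, b}" "P2 \<inter> P3 = {a, b}"
    and no: "P1 \<inter> inside (P2 \<union> P3) = {}" "P2 \<inter> inside (P1 \<union> P3) = {}"
  shows "inside (P2 \<union> P3) \<subseteq> outside (P1 \<union> P3)"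
proof (rule ccontr)
  note J23 = Jordan_arcs[OF ab P(2,3) I(3)] and J13 = Jordan_arcs[OF ab P(1,3) I(2)]
  assume nt: "\<not> inside (P2 \<union> P3) \<subseteq> outside (P1 \<union> P3)"
  have "inside (P2 \<union> P3) \<inter> (P1 \<union> P3) = {}" using no(1) inside_no_overlap[of "P2 \<union> P3"] by blast
  then have 1: "inside (P2 \<union> P3) \<subseteq> inside (P1 \<union> P3)"
    using connected_inside_or_outside[OF ab P(1,3) I(2) J23(3)] nt by blast
  have "inside (P1 \<union> P3) \<inter> (P2 \<union> P3) = {}" using no(2) inside_no_overlap[of "P1 \<union> P3"] by blast
  then have "inside (P1 \<union> P3) \<subseteq> inside (P2 \<union> P3) \<or> inside (P1 \<union> P3) \<subseteq> outside (P2 \<union> P3)"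
    using connected_inside_or_outside[OF ab P(2,3) I(3) J13(3)] by blast
  then have "inside (P1 \<union> P3) = inside (P2 \<union> P3)"
    using 1 J23(1) inside_Int_outside[of "P2 \<union> P3"] by blast
  then have "P1 \<union> P3 = P2 \<union> P3" using J13(6) J23(6) by metis
  then show False using arc_between_interior_nonempty[OF ab P(1)] I by blast
qed

text \<open>If no arc of a theta curve ran inside the other two, a point inside \<open>P2 \<union> P3\<close> would be
  separated from infinity neither by \<open>P1 \<union> P2\<close> nor by \<open>P1 \<union> P3\<close>, hence by Janiszewski's theorem
  not by the whole theta curve.\<close>
lemma theta_curve:
  assumes ab: "a \<noteq> b" and P: "arc_between a b P1" "arc_between a b P2" "arc_between a b P3"
    and I: "P1 \<inter> P2 = {a, b}" "P1 \<inter> P3 = {a, b}" "P2 \<inter> P3 = {a, b}"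
  shows "P1 \<inter> inside (P2 \<union> P3) \<noteq> {} \<or> P2 \<inter> inside (P1 \<union> P3) \<noteq> {} \<or> P3 \<inter> inside (P1 \<union> P2) \<noteq> {}"
proof (rule ccontr)
  assume "\<not> ?thesis"
  then have no: "P1 \<inter> inside (P2 \<union> P3) = {}" "P2 \<inter> inside (P1 \<union> P3) = {}"
      "P3 \<inter> inside (P1 \<union> P2) = {}" by auto
  note J23 = Jordan_arcs[OF ab P(2,3) I(3)] and J13 = Jordan_arcs[OF ab P(1,3) I(2)]
    and J12 = Jordan_arcs[OF ab P(1,2) I(1)]
  have cpt: "compact P1" "compact P2" "compact P3" using P compact_arc_between by auto
  obtain y where y: "y \<in> inside (P2 \<union> P3)" using J23(1) by blast
  have y13: "y \<in> outside (P1 \<union> P3)"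
    using theta_insides_apart[OF ab P I no(1,2)] y by blast
  have y12: "y \<in> outside (P1 \<union> P2)"
  proof -
    \<comment> \<open>The roles of \<open>P2\<close> and \<open>P3\<close> are exchanged
      here.\<close>
    have "inside (P3 \<union> P2) \<subseteq> outside (P1 \<union> P2)"
    proof (rule theta_insides_apart[OF ab P(1,3,2) I(2,1)])
      show "P3 \<inter> P2 = {a, b}" using I(3) by blast
      show "P1 \<inter> inside (P3 \<union> P2) = {}" using no(1) by (simp only: Un_commute)
    qed (fact no(3))
    moreover have "y \<in> inside (P3 \<union> P2)" using y by (simp only: Un_commute)
    ultimately show ?thesis by blast
  qed
  have "bounded (P1 \<union> P2 \<union> P3)" using cpt by (simp add: compact_imp_bounded)
  then have "outside (P1 \<union> P2 \<union> P3) \<noteq> {}"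
    by (rule outside_bounded_nonempty)
  then obtain z where z: "z \<in> outside (P1 \<union> P2 \<union> P3)" by blast
  then have zo: "z \<in> outside (P1 \<union> P2)" "z \<in> outside (P1 \<union> P3)" "z \<in> outside (P2 \<union> P3)"
    using outside_mono[of _ "P1 \<union> P2 \<union> P3"] by blast+
  have 12: "connected_component (- (P1 \<union> P2)) y z"
    unfolding connected_component_def using J12(5) y12 zo(1) outside_no_overlap[of "P1 \<union> P2"]
    by (intro exI[of _ "outside (P1 \<union> P2)"] conjI) blast+
  have 13: "connected_component (- (P1 \<union> P3)) y z"
    unfolding connected_component_def using J13(5) y13 zo(2) outside_no_overlap[of "P1 \<union> P3"]
    by (intro exI[of _ "outside (P1 \<union> P3)"] conjI) blast+
  \<comment> \<open>Janiszewski's theorem requires the two sets to meet in a connected set, here the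
    common arc \<open>P1\<close>.\<close>
  have "(P1 \<union> P2) \<inter> (P1 \<union> P3) = P1" using I arc_between_ends[OF P(1)] by blast
  moreover have "connected P1" using P(1) connected_arc_image ab unfolding arc_between_def by blast
  ultimately have "connected_component (- ((P1 \<union> P2) \<union> (P1 \<union> P3))) y z"
    using cpt by (intro Janiszewski[OF _ _ _ 12 13]) (simp_all add: compact_Un compact_imp_closed closed_Un)
  \<comment> \<open>Already the complement of \<open>P2 \<union> P3\<close> then has
    \<open>y\<close> and \<open>z\<close> in one component, although that of \<open>y\<close> is
    bounded and that of \<open>z\<close> is not.\<close>
  then have "connected_component (- (P2 \<union> P3)) y z"
    by (rule connected_component_of_subset) auto
  then have "z \<in> connected_component_set (- (P2 \<union> P3)) y" by simp
  then have "connected_component_set (- (P2 \<union> P3)) z = connected_component_set (- (P2 \<union> P3)) y"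
    by (rule connected_component_eq)
  moreover have "bounded (connected_component_set (- (P2 \<union> P3)) y)"
    using y unfolding inside_def by blast
  moreover have "\<not> bounded (connected_component_set (- (P2 \<union> P3)) z)"
    using zo(3) unfolding outside_def by blast
  ultimately show False by simp
qed

text \<open>The arc that meets the inside of the other two lies there with its whole interior, so
  this open inside is a neighbourhood of its marked point. It misses \<open>outside X\<close>, since
  \<open>X\<close> contains the other two arcs, and so the point is not on the frontier of
  \<open>outside X\<close>.\<close>

lemma no_theta_on_outer_face:
  assumes ab: "a \<noteq> b" and P: "arc_between a b P1" "arc_between a b P2" "arc_between a b P3"
    and I: "P1 \<inter> P2 = {a, b}" "P1 \<inter> P3 = {a, b}" "P2 \<inter> P3 = {a, b}"
    and x: "x1 \<in> P1 - {a, b}" "x2 \<in> P2 - {a, b}" "x3 \<in> P3 - {a, b}"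
    and X: "P1 \<union> P2 \<union> P3 \<subseteq> X" and fr: "{x1, x2, x3} \<subseteq> frontier (outside X)"
  shows False
proof -
  have key: False
    if "arc_between a b P" "arc_between a b Q" "arc_between a b R" "P \<inter> Q = {a, b}"
      "P \<inter> R = {a, b}" "Q \<inter> R = {a, b}" "x \<in> P - {a, b}" "x \<in> frontier (outside X)" "Q \<union> R \<subseteq> X"
      "P \<inter> inside (Q \<union> R) \<noteq> {}" for P Q R x
  proof -
    note J = Jordan_arcs[OF ab that(2,3,6)]
    have "(P - {a, b}) \<inter> (Q \<union> R) = {}" using that by auto
    then have "P - {a, b} \<subseteq> inside (Q \<union> R) \<or> P - {a, b} \<subseteq> outside (Q \<union> R)"
      using connected_inside_or_outside[OF ab that(2,3,6)] connected_arc_between_interior[OF that(1)]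
      by blast
    moreover have "(P - {a, b}) \<inter> inside (Q \<union> R) \<noteq> {}"
      using that(10) inside_no_overlap[of "Q \<union> R"] arc_between_ends[OF that(2)] by blast
    ultimately have "x \<in> inside (Q \<union> R)"
      using that(7) inside_Int_outside[of "Q \<union> R"] by blast
    moreover have "x \<in> closure (outside X)" using that(8) by (simp add: frontier_def)
    ultimately have "inside (Q \<union> R) \<inter> outside X \<noteq> {}"
      using open_Int_closure_eq_empty[OF J(2)] by blast
    then show False
      using outside_mono[OF that(9)] inside_Int_outside[of "Q \<union> R"] by blast
  qed
  have I': "P2 \<inter> P1 = {a, b}" "P3 \<inter> P1 = {a, b}" "P3 \<inter> P2 = {a, b}" using I by auto
  consider "P1 \<inter> inside (P2 \<union> P3) \<noteq> {}" | "P2 \<inter> inside (P1 \<union> P3) \<noteq> {}"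
    | "P3 \<inter> inside (P1 \<union> P2) \<noteq> {}"
    using theta_curve[OF ab P I] by blast
  then show False
  proof cases
    case 1
    show ?thesis by (rule key[OF P(1,2,3) I, of x1]) (use x X fr 1 in simp_all)
  next
    case 2
    show ?thesis by (rule key[OF P(2,1,3) I'(1) I(3,2), of x2]) (use x X fr 2 in simp_all)
  next
    case 3
    show ?thesis by (rule key[OF P(3,1,2) I'(2,3) I(1), of x3]) (use x X fr 3 in simp_all)
  qed
qed

section \<open>Outerplanar drawings\<close>

lemma plane_embeddingD:
  assumes "plane_embedding V E p c"
  shows "inj_on p V"
    and "e \<in> E \<Longrightarrow> arc (c e)"
    and "e \<in> E \<Longrightarrow> {pathstart (c e), pathfinish (c e)} = p ` e"
    and "e \<in> E \<Longrightarrow> path_image (c e) \<inter> p ` V = p ` e"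
    and "e \<in> E \<Longrightarrow> f \<in> E \<Longrightarrow> e \<noteq> f \<Longrightarrow> path_image (c e) \<inter> path_image (c f) \<subseteq> p ` (e \<inter> f)"
  using assms by (simp_all add: plane_embedding_def)

text \<open>Disjointness of the edge sets makes the condition on distinct arcs applicable to every
  pair of arcs; a vertex lying on an arc is an end of its edge, which is \<open>ev\<close>.\<close>

lemma drawing_Int:
  assumes pe: "plane_embedding V E p c" and V: "V1 \<subseteq> V" "V2 \<subseteq> V" and E: "E1 \<subseteq> E" "E2 \<subseteq> E"
    and dis: "E1 \<inter> E2 = {}" and sub: "\<And>e. e \<in> E1 \<Longrightarrow> e \<subseteq> V1" "\<And>e. e \<in> E2 \<Longrightarrow> e \<subseteq> V2"
  shows "drawing V1 E1 p c \<inter> drawing V2 E2 p c \<subseteq> p ` (V1 \<inter> V2)"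
proof
  note inj = plane_embeddingD(1)[OF pe]
  have ev: "z \<in> p ` (e \<inter> W)" if "e \<in> E" "e \<subseteq> V" "W \<subseteq> V" "z \<in> path_image (c e)" "z \<in> p ` W" for z e W
  proof -
    have "z \<in> p ` e \<inter> p ` W" using plane_embeddingD(4)[OF pe that(1)] that(3-5) by blast
    then show ?thesis using inj_on_image_Int[OF inj that(2,3)] by simp
  qed
  fix z assume "z \<in> drawing V1 E1 p c \<inter> drawing V2 E2 p c"
  then consider "z \<in> p ` V1" "z \<in> p ` V2"
    | e where "e \<in> E1" "z \<in> path_image (c e)" "z \<in> p ` V2"
    | e where "e \<in> E2" "z \<in> path_image (c e)" "z \<in> p ` V1"
    | e f where "e \<in> E1" "f \<in> E2" "z \<in> path_image (c e)" "z \<in> path_image (c f)"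
    unfolding drawing_def by blast
  then show "z \<in> p ` (V1 \<inter> V2)"
  proof cases
    case 1
    then show ?thesis using inj_on_image_Int[OF inj V] by simp
  next
    case 2
    then have "z \<in> p ` (e \<inter> V2)" using ev[of e V2 z] E V sub(1)[of e] by blast
    then show ?thesis using sub(1)[OF 2(1)] by blast
  next
    case 3
    then have "z \<in> p ` (e \<inter> V1)" using ev[of e V1 z] E V sub(2)[of e] by blast
    then show ?thesis using sub(2)[OF 3(1)] by blast
  next
    case 4
    then have "e \<in> E" "f \<in> E" "e \<noteq> f" using E dis by auto
    then have "path_image (c e) \<inter> path_image (c f) \<subseteq> p ` (e \<inter> f)"
      by (rule plane_embeddingD(5)[OF pe])
    then have "z \<in> p ` (e \<inter> f)" using 4 by blast
    then show ?thesis using sub(1)[OF 4(1)] sub(2)[OF 4(2)] by blast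
  qed
qed

text \<open>Only the unordered pair of ends is prescribed by the embedding, so the arc may have to
  be reversed.\<close>

lemma arc_between_edge:
  assumes pe: "plane_embedding V E p c" and e: "{u, v} \<in> E"
  shows "arc_between (p u) (p v) (path_image (c {u, v}))"
proof -
  note * = plane_embeddingD(2,3)[OF pe e]
  have "{pathstart (c {u, v}), pathfinish (c {u, v})} = {p u, p v}" using *(2) by simp
  then consider "pathstart (c {u, v}) = p u" "pathfinish (c {u, v}) = p v"
    | "pathstart (c {u, v}) = p v" "pathfinish (c {u, v}) = p u"
    unfolding doubleton_eq_iff by blast
  then show ?thesis
  proof cases
    case 1
    then show ?thesis using arc_between_arc[OF *(1)] by simp
  next
    case 2
    then show ?thesis using arc_between_sym[OF arc_between_arc[OF *(1)]] by simp
  qed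
qed

abbreviation induced_edges :: "'a set set \<Rightarrow> 'a set \<Rightarrow> 'a set set" where
  "induced_edges E A \<equiv> {e \<in> E. e \<subseteq> A}"

lemma path_connected_drawing:
  assumes pe: "plane_embedding V E p c" and A: "connected_in (\<lambda>u v. {u, v} \<in> E) A"
  shows "path_connected (drawing A (induced_edges E A) p c)"
proof -
  let ?D = "drawing A (induced_edges E A) p c"
  obtain a where a: "a \<in> A" using connected_in_nonempty[OF A] by blast
  have sub: "path_image (c e) \<subseteq> ?D" if "e \<in> E" "e \<subseteq> A" for e
    using that unfolding drawing_def by blast
  have edge: "path_component ?D y z" if "e \<in> E" "e \<subseteq> A" "y \<in> path_image (c e)" "z \<in> path_image (c e)" for e y z
  proof -
    have "path (c e)" by (rule arc_imp_path[OF plane_embeddingD(2)[OF pe that(1)]])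
    then have "path_component (path_image (c e)) y z"
      using path_connected_path_image that(3,4) unfolding path_connected_component by blast
    then show ?thesis by (rule path_component_of_subset[OF sub[OF that(1,2)]])
  qed
  have vert: "p u \<in> path_image (c e)" if "e \<in> E" "u \<in> e" for e u
    using plane_embeddingD(4)[OF pe that(1)] that(2) by blast
  \<comment> \<open>\<open>X\<close> collects the vertices reachable from \<open>a\<close> within
    the drawing. An edge leaving \<open>X\<close> would make its other end reachable too, so by
    connectedness \<open>X\<close> is all of \<open>A\<close>.\<close>
  define X where "X = {x\<in>A. path_component ?D (p a) (p x)}"
  have "p a \<in> ?D" using a by (simp add: drawing_def)
  then have "a \<in> X" using a path_component_refl by (simp add: X_def)
  have "X = A"
  proof (rule ccontr)
    assume "X \<noteq> A"
    then obtain x y where xy: "x \<in> X" "y \<in> A - X" "{x, y} \<in> E"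
      using connected_inE[OF A, of X] \<open>a \<in> X\<close> unfolding X_def by blast
    then have "path_component ?D (p x) (p y)"
      by (intro edge[of "{x, y}"] vert) (auto simp: X_def)
    then have "y \<in> X" using xy path_component_trans unfolding X_def by blast
    then show False using xy by simp
  qed
  have "path_component ?D (p a) z" if "z \<in> ?D" for z
  proof -
    from that consider x where "x \<in> A" "z = p x" | e where "e \<in> E" "e \<subseteq> A" "z \<in> path_image (c e)"
      unfolding drawing_def by blast
    then show ?thesis
    proof cases
      case 1
      then show ?thesis using \<open>X = A\<close> unfolding X_def by blast
    next
      case 2
      have "pathstart (c e) \<in> p ` e" using plane_embeddingD(3)[OF pe 2(1)] by blast
      then obtain x where x: "x \<in> e" by blast
      then have "path_component ?D (p x) z" using edge[of e "p x" z] vert 2 by blast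
      moreover have "path_component ?D (p a) (p x)" using x 2 \<open>X = A\<close> unfolding X_def by blast
      ultimately show ?thesis using path_component_trans by blast
    qed
  qed
  then show ?thesis
    unfolding path_connected_component by (blast intro: path_component_trans path_component_sym)
qed

text \<open>The arc runs along an edge to \<open>x\<close>, through the drawing of \<open>C\<close>
  to \<open>y\<close>, and along an edge to \<open>v\<close>; by \<open>drawing_Int\<close> each new
  piece meets the previous ones only where it is attached. The vertex \<open>x\<close> is kept track
  of as the future point on the outer face.\<close>

lemma arc_between_through:
  assumes pe: "plane_embedding V E p c" and CV: "C \<subseteq> V" "u \<in> V - C" "v \<in> V - C" "u \<noteq> v"
    and C: "connected_in (\<lambda>u v. {u, v} \<in> E) C" and e: "{u, x} \<in> E" "{v, y} \<in> E" "x \<in> C" "y \<in> C"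
  obtains W where "arc_between (p u) (p v) W" "p x \<in> W"
    "W \<subseteq> drawing (C \<union> {u, v}) (induced_edges E C \<union> {{u, x}, {v, y}}) p c"
proof -
  let ?D = "drawing C (induced_edges E C) p c"
  let ?U = "path_image (c {u, x})" and ?V = "path_image (c {v, y})"
  have "p x \<in> ?D" "p y \<in> ?D" using e by (auto simp: drawing_def)
  then obtain Q where Q: "Q \<subseteq> ?D" "arc_between (p x) (p y) Q"
    using arc_between_exists[OF path_connected_drawing[OF pe C]] by blast
  have arcs: "arc_between (p u) (p x) ?U" "arc_between (p y) (p v) ?V"
    using arc_between_edge[OF pe e(1)] arc_between_sym[OF arc_between_edge[OF pe e(2)]] by auto
  have 1: "?U \<inter> Q \<subseteq> {p x}"
  proof -
    have "drawing {u, x} {{u, x}} p c \<inter> ?D \<subseteq> p ` ({u, x} \<inter> C)"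
      by (rule drawing_Int[OF pe]) (use CV e in auto)
    also have "{u, x} \<inter> C = {x}" using CV e by auto
    finally have "drawing {u, x} {{u, x}} p c \<inter> ?D \<subseteq> {p x}" by simp
    moreover have "?U \<subseteq> drawing {u, x} {{u, x}} p c" by (auto simp: drawing_def)
    ultimately show ?thesis using Q(1) by blast
  qed
  have 2: "(?U \<union> Q) \<inter> ?V \<subseteq> {p y}"
  proof -
    have "drawing (C \<union> {u}) (induced_edges E C \<union> {{u, x}}) p c \<inter> drawing {v, y} {{v, y}} p c
        \<subseteq> p ` ((C \<union> {u}) \<inter> {v, y})"
      by (rule drawing_Int[OF pe]) (use CV e in \<open>auto simp: doubleton_eq_iff\<close>)
    also have "(C \<union> {u}) \<inter> {v, y} = {y}" using CV e by auto
    finally have "drawing (C \<union> {u}) (induced_edges E C \<union> {{u, x}}) p c \<inter> drawing {v, y} {{v, y}} p c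
        \<subseteq> {p y}" by simp
    moreover have "?V \<subseteq> drawing {v, y} {{v, y}} p c" by (auto simp: drawing_def)
    moreover have "?U \<union> Q \<subseteq> drawing (C \<union> {u}) (induced_edges E C \<union> {{u, x}}) p c"
      using Q(1) by (auto simp: drawing_def)
    ultimately show ?thesis by blast
  qed
  show ?thesis
  proof (rule that[of "(?U \<union> Q) \<union> ?V"])
    show "arc_between (p u) (p v) ((?U \<union> Q) \<union> ?V)"
      using arc_between_join[OF arc_between_join[OF arcs(1) Q(2) 1] arcs(2) 2] .
    show "p x \<in> (?U \<union> Q) \<union> ?V" using arc_between_ends[OF arcs(1)] by blast
    show "(?U \<union> Q) \<union> ?V \<subseteq> drawing (C \<union> {u, v}) (induced_edges E C \<union> {{u, x}, {v, y}}) p c"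
      using Q(1) by (auto simp: drawing_def)
  qed
qed

text \<open>A minor model yields a theta curve: its branch points are the centres of tripods in the
  drawings of \<open>A\<close> and \<open>B\<close>, and its three arcs pass through
  \<open>C 0\<close>, \<open>C 1\<close>, \<open>C 2\<close>. Each arc has a vertex in its interior,
  which lies on the outer face, against \<open>no_theta_on_outer_face\<close>.\<close>

lemma outerplanar_no_K23_minor:
  assumes outer: "outerplanar V E"
  shows "\<not> K23_minor (\<lambda>u v. {u, v} \<in> E) V"
proof
  let ?r = "\<lambda>u v. {u, v} \<in> E"
  assume m: "K23_minor ?r V"
  obtain A B C where AB: "A \<subseteq> V" "B \<subseteq> V" "A \<inter> B = {}" "connected_in ?r A" "connected_in ?r B"
    and C: "\<And>i. i < (3::nat) \<Longrightarrow> C i \<subseteq> V \<and> C i \<inter> (A \<union> B) = {} \<and> connected_in ?r (C i) \<and>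
           touches ?r A (C i) \<and> touches ?r B (C i)"
    and dC: "\<And>i j. i < 3 \<Longrightarrow> j < 3 \<Longrightarrow> i \<noteq> j \<Longrightarrow> C i \<inter> C j = {}"
    using K23_minorE[OF m] by blast
  obtain p c where pe: "plane_embedding V E p c"
    and fr: "p ` V \<subseteq> frontier (outside (drawing V E p c))"
    using outer unfolding outerplanar_def by blast
  note inj = plane_embeddingD(1)[OF pe]
  have "\<forall>i. \<exists>u x. i < 3 \<longrightarrow> u \<in> A \<and> x \<in> C i \<and> {u, x} \<in> E"
    using C unfolding touches_def by meson
  then obtain u x where u: "\<And>i. i < 3 \<Longrightarrow> u i \<in> A \<and> x i \<in> C i \<and> {u i, x i} \<in> E" by metis
  have "\<forall>i. \<exists>v y. i < 3 \<longrightarrow> v \<in> B \<and> y \<in> C i \<and> {v, y} \<in> E"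
    using C unfolding touches_def by meson
  then obtain v y where v: "\<And>i. i < 3 \<Longrightarrow> v i \<in> B \<and> y i \<in> C i \<and> {v i, y i} \<in> E" by metis
  let ?DA = "drawing A (induced_edges E A) p c" and ?DB = "drawing B (induced_edges E B) p c"
  let ?DC = "\<lambda>i. drawing (C i \<union> {u i, v i}) (induced_edges E (C i) \<union> {{u i, x i}, {v i, y i}}) p c"
  have "\<forall>i. \<exists>W. i < 3 \<longrightarrow> arc_between (p (u i)) (p (v i)) W \<and> p (x i) \<in> W \<and> W \<subseteq> ?DC i"
  proof (intro allI)
    fix i show "\<exists>W. i < 3 \<longrightarrow> arc_between (p (u i)) (p (v i)) W \<and> p (x i) \<in> W \<and> W \<subseteq> ?DC i"
    proof (cases "i < 3")
      case True
      have "C i \<subseteq> V" "u i \<in> V - C i" "v i \<in> V - C i" "u i \<noteq> v i"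
        using C[OF True] u[OF True] v[OF True] AB by auto
      moreover have "connected_in ?r (C i)" "{u i, x i} \<in> E" "{v i, y i} \<in> E" "x i \<in> C i" "y i \<in> C i"
        using C[OF True] u[OF True] v[OF True] by auto
      ultimately obtain Wi where "arc_between (p (u i)) (p (v i)) Wi" "p (x i) \<in> Wi" "Wi \<subseteq> ?DC i"
        using arc_between_through[OF pe] by blast
      then show ?thesis by blast
    qed simp
  qed
  from choice[OF this] obtain W where W: "\<And>i. i < 3 \<Longrightarrow> arc_between (p (u i)) (p (v i)) (W i)"
      "\<And>i. i < 3 \<Longrightarrow> p (x i) \<in> W i" "\<And>i. i < 3 \<Longrightarrow> W i \<subseteq> ?DC i" by blast
  have uD: "p (u i) \<in> ?DA" and vD: "p (v i) \<in> ?DB" if "i < 3" for i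
    using u[OF that] v[OF that] by (auto simp: drawing_def)
  obtain a R where a: "a \<in> ?DA" and R: "\<And>i. i < 3 \<Longrightarrow> arc_between (p (u i)) a (R i) \<and> R i \<subseteq> ?DA"
      and RR: "\<And>i j. i < 3 \<Longrightarrow> j < 3 \<Longrightarrow> i \<noteq> j \<Longrightarrow> R i \<inter> R j = {a}"
    using tripod[where x = "\<lambda>i. p (u i)", OF path_connected_drawing[OF pe AB(4)] uD] by blast
  obtain b T where b: "b \<in> ?DB" and T: "\<And>i. i < 3 \<Longrightarrow> arc_between (p (v i)) b (T i) \<and> T i \<subseteq> ?DB"
      and TT: "\<And>i j. i < 3 \<Longrightarrow> j < 3 \<Longrightarrow> i \<noteq> j \<Longrightarrow> T i \<inter> T j = {b}"
    using tripod[where x = "\<lambda>i. p (v i)", OF path_connected_drawing[OF pe AB(5)] vD] by blast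
  \<comment> \<open>An empty edge would be induced on every vertex set and so spoil the disjointness
    of edge sets that \<open>drawing_Int\<close> demands.\<close>
  have ne: "e \<noteq> {}" if "e \<in> E" for e
    using plane_embeddingD(3)[OF pe that] by auto
  have dAB: "?DA \<inter> ?DB = {}"
  proof -
    have "?DA \<inter> ?DB \<subseteq> p ` (A \<inter> B)"
      by (rule drawing_Int[OF pe]) (use AB ne in blast)+
    then show ?thesis using AB by simp
  qed
  have WA: "W i \<inter> ?DA \<subseteq> {p (u i)}" and WB: "W i \<inter> ?DB \<subseteq> {p (v i)}" if i: "i < 3" for i
  proof -
    have "?DC i \<inter> ?DA \<subseteq> p ` ((C i \<union> {u i, v i}) \<inter> A)"
      by (rule drawing_Int[OF pe]) (use AB C[OF i] u[OF i] v[OF i] ne in blast)+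
    also have "(C i \<union> {u i, v i}) \<inter> A = {u i}" using AB C[OF i] u[OF i] v[OF i] by auto
    finally show "W i \<inter> ?DA \<subseteq> {p (u i)}" using W(3)[OF i] by auto
    have "?DC i \<inter> ?DB \<subseteq> p ` ((C i \<union> {u i, v i}) \<inter> B)"
      by (rule drawing_Int[OF pe]) (use AB C[OF i] u[OF i] v[OF i] ne in blast)+
    also have "(C i \<union> {u i, v i}) \<inter> B = {v i}" using AB C[OF i] u[OF i] v[OF i] by auto
    finally show "W i \<inter> ?DB \<subseteq> {p (v i)}" using W(3)[OF i] by auto
  qed
  \<comment> \<open>Passages through different sets \<open>C i\<close> can meet only in attachment
    vertices in \<open>A\<close> or \<open>B\<close>: every edge of \<open>F k\<close> meets
    \<open>C k\<close>, so no edge is shared.\<close>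
  have WW: "W i \<inter> W j \<subseteq> ?DA \<union> ?DB" if i: "i < 3" and j: "j < 3" and ij: "i \<noteq> j" for i j
  proof -
    define F where "F k = induced_edges E (C k) \<union> {{u k, x k}, {v k, y k}}" for k
    have sub: "e \<subseteq> C k \<union> {u k, v k}" "e \<inter> C k \<noteq> {}" "e \<in> E" if "e \<in> F k" "k < 3" for e k
      using that(1) u[OF that(2)] v[OF that(2)] ne unfolding F_def by blast+
    have CV: "C k \<union> {u k, v k} \<subseteq> V" if "k < 3" for k
      using AB C[OF that] u[OF that] v[OF that] by blast
    have dis: "C i \<inter> (C j \<union> {u j, v j}) = {}"
      using C[OF i] u[OF j] v[OF j] dC[OF i j ij] by blast
    have "F i \<inter> F j = {}"
    proof (rule equals0I)
      fix e assume "e \<in> F i \<inter> F j"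
      then have "e \<inter> C i \<noteq> {}" "e \<subseteq> C j \<union> {u j, v j}" using sub(2)[of e i] sub(1)[of e j] i j by simp_all
      with dis show False by blast
    qed
    moreover have "F i \<subseteq> E" "F j \<subseteq> E" using sub(3) i j by blast+
    ultimately have "?DC i \<inter> ?DC j \<subseteq> p ` ((C i \<union> {u i, v i}) \<inter> (C j \<union> {u j, v j}))"
      using drawing_Int[OF pe CV[OF i] CV[OF j], of "F i" "F j"] sub(1)[OF _ i] sub(1)[OF _ j]
      unfolding F_def by simp
    also have "\<dots> \<subseteq> p ` (A \<union> B)"
      using C[OF i] u[OF i] v[OF i] C[OF j] u[OF j] v[OF j] dC[OF i j ij] by blast
    also have "\<dots> \<subseteq> ?DA \<union> ?DB" by (auto simp: drawing_def)
    finally show ?thesis using W(3)[OF i] W(3)[OF j] by blast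
  qed
  define P where "P i = (R i \<union> W i) \<union> T i" for i
  have P: "arc_between a b (P i)" if i: "i < 3" for i
    unfolding P_def
  proof (rule arc_between_join[OF arc_between_join[OF arc_between_sym W(1)[OF i]]])
    show "arc_between (p (u i)) a (R i)" "arc_between (p (v i)) b (T i)"
      using R[OF i] T[OF i] by auto
    show "R i \<inter> W i \<subseteq> {p (u i)}" using R[OF i] WA[OF i] by blast
    show "(R i \<union> W i) \<inter> T i \<subseteq> {p (v i)}" using R[OF i] T[OF i] WB[OF i] dAB by blast
  qed
  have I: "P i \<inter> P j = {a, b}" if i: "i < 3" and j: "j < 3" and ij: "i \<noteq> j" for i j
  proof
    note ends = arc_between_ends[OF conjunct1[OF R[OF i]]] arc_between_ends[OF conjunct1[OF R[OF j]]]
      arc_between_ends[OF conjunct1[OF T[OF i]]] arc_between_ends[OF conjunct1[OF T[OF j]]]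
    note sub = conjunct2[OF R[OF i]] conjunct2[OF R[OF j]] conjunct2[OF T[OF i]] conjunct2[OF T[OF j]]
    have A': "z = a" if "z \<in> P i" "z \<in> P j" "z \<in> ?DA" for z
    proof -
      have "z \<in> R i" using that(1,3) WA[OF i] ends(1) sub(3) dAB unfolding P_def by blast
      moreover have "z \<in> R j" using that(2,3) WA[OF j] ends(2) sub(4) dAB unfolding P_def by blast
      ultimately show ?thesis using RR[OF i j ij] by blast
    qed
    have B': "z = b" if "z \<in> P i" "z \<in> P j" "z \<in> ?DB" for z
    proof -
      have "z \<in> T i" using that(1,3) WB[OF i] ends(3) sub(1) dAB unfolding P_def by blast
      moreover have "z \<in> T j" using that(2,3) WB[OF j] ends(4) sub(2) dAB unfolding P_def by blast
      ultimately show ?thesis using TT[OF i j ij] by blast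
    qed
    show "P i \<inter> P j \<subseteq> {a, b}"
    proof
      fix z assume z: "z \<in> P i \<inter> P j"
      then have "z \<in> ?DA \<union> ?DB" using sub WW[OF i j ij] unfolding P_def by blast
      then show "z \<in> {a, b}" using A' B' z by blast
    qed
    show "{a, b} \<subseteq> P i \<inter> P j" using ends unfolding P_def by blast
  qed
  \<comment> \<open>\<open>W i\<close> meets the drawings of \<open>A\<close> and \<open>B\<close>
    only in the positions of \<open>u i\<close> and \<open>v i\<close>, which differ from that of
    \<open>x i\<close> by injectivity. So \<open>p (x i)\<close> avoids both drawings, and these
    contain \<open>a\<close> and \<open>b\<close>.\<close>
  have xP: "p (x i) \<in> P i - {a, b}" if i: "i < 3" for i
  proof -
    have "x i \<notin> A \<union> B" "x i \<in> V" using C[OF i] u[OF i] by auto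
    moreover have "p (x i) = p (u i) \<Longrightarrow> x i = u i" "p (x i) = p (v i) \<Longrightarrow> x i = v i"
      using inj AB u[OF i] v[OF i] C[OF i] unfolding inj_on_def by blast+
    ultimately have "p (x i) \<noteq> p (u i)" "p (x i) \<noteq> p (v i)" using u[OF i] v[OF i] by auto
    then have "p (x i) \<notin> ?DA \<union> ?DB" using WA[OF i] WB[OF i] W(2)[OF i] by blast
    then show ?thesis using a b W(2)[OF i] unfolding P_def by blast
  qed
  have DV: "drawing X F p c \<subseteq> drawing V E p c" if "X \<subseteq> V" "F \<subseteq> E" for X F
    using that unfolding drawing_def by blast
  have PX: "P i \<subseteq> drawing V E p c" if i: "i < 3" for i
  proof -
    have "?DA \<subseteq> drawing V E p c" "?DB \<subseteq> drawing V E p c" by (rule DV[OF AB(1)], blast, rule DV[OF AB(2)], blast)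
    moreover have "?DC i \<subseteq> drawing V E p c"
      using AB C[OF i] u[OF i] v[OF i] by (intro DV) auto
    ultimately show ?thesis using R[OF i] T[OF i] W(3)[OF i] unfolding P_def by blast
  qed
  have xf: "p (x i) \<in> frontier (outside (drawing V E p c))" if i: "i < 3" for i
    using fr C[OF i] u[OF i] by blast
  show False
  proof (rule no_theta_on_outer_face[of a b "P 0" "P 1" "P 2" "p (x 0)" "p (x 1)" "p (x 2)"])
    show "a \<noteq> b" using a b dAB by blast
    show "P 0 \<union> P 1 \<union> P 2 \<subseteq> drawing V E p c" using PX[of 0] PX[of 1] PX[of 2] by simp
    show "{p (x 0), p (x 1), p (x 2)} \<subseteq> frontier (outside (drawing V E p c))"
      using xf[of 0] xf[of 1] xf[of 2] by simp
  qed (use P I xP in auto)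
qed

section \<open>Slater number and domination\<close>

text \<open>Sorting the vertices by degree exhibits the degree sequence as the image of a list of
  distinct vertices, whose first \<open>s\<close> entries form \<open>S\<close>.\<close>

lemma degree_sequence_take:
  assumes "finite V" "s \<le> card V"
  obtains S where "S \<subseteq> V" "card S = s"
    "(\<Sum>d\<leftarrow>take s (degree_sequence V E). d + 1) = (\<Sum>v\<in>S. vertex_degree E v + 1)"
proof -
  obtain xs where xs: "set xs = V" "distinct xs" using assms finite_distinct_list by blast
  let ?d = "vertex_degree E"
  define ys where "ys = rev (sort_key ?d xs)"
  have "mset_set V = mset xs" using xs mset_set_set by blast
  then have "degree_sequence V E = rev (sort (map ?d xs))"
    by (simp add: degree_sequence_def flip: mset_map)
  also have "sort (map ?d xs) = map ?d (sort_key ?d xs)"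
    by (rule properties_for_sort) simp_all
  finally have seq: "degree_sequence V E = map ?d ys" by (simp add: ys_def rev_map)
  have ys: "distinct ys" "set ys = V" "length ys = card V"
    using xs distinct_card[of xs] by (auto simp: ys_def)
  show ?thesis
  proof (rule that[of "set (take s ys)"])
    show "set (take s ys) \<subseteq> V" using ys set_take_subset by metis
    show "card (set (take s ys)) = s" using ys assms by (simp add: distinct_card)
    show "(\<Sum>d\<leftarrow>take s (degree_sequence V E). d + 1) = (\<Sum>v\<in>set (take s ys). ?d v + 1)"
      using ys by (simp add: seq take_map sum_list_distinct_conv_sum_set comp_def flip: sum_list_distinct_conv_sum_set)
  qed
qed

text \<open>The minimum is attained because \<open>card V\<close> qualifies, every term of the sum
  being at least 1. This also gives \<open>slater_number V E \<le> card V\<close>, so that taking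
  that many degrees uses exactly that many vertices.\<close>

lemma slater_number_witness:
  assumes "finite V" "slater_number V E \<ge> 2"
  obtains S where "S \<subseteq> V" "card S = slater_number V E"
    "card V \<le> (\<Sum>v\<in>S. vertex_degree E v + 1)"
proof -
  let ?P = "\<lambda>s. s \<ge> 1 \<and> (\<Sum>d\<leftarrow>take s (degree_sequence V E). d + 1) \<ge> card V"
  have "V \<noteq> {}"
  proof
    assume "V = {}"
    then have "slater_number V E \<le> 1" unfolding slater_number_def by (intro Least_le) simp
    then show False using assms by simp
  qed
  obtain S where "S \<subseteq> V" "card S = card V"
    "(\<Sum>d\<leftarrow>take (card V) (degree_sequence V E). d + 1) = (\<Sum>v\<in>S. vertex_degree E v + 1)"
    using degree_sequence_take[OF assms(1) order_refl] by metis
  moreover have "card S \<le> (\<Sum>v\<in>S. vertex_degree E v + 1)" by (simp add: sum.distrib sum_Suc)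
  ultimately have PV: "?P (card V)" using assms \<open>V \<noteq> {}\<close> by (simp add: Suc_le_eq card_gt_0_iff)
  have le: "slater_number V E \<le> card V" unfolding slater_number_def using PV by (rule Least_le)
  have "?P (slater_number V E)" unfolding slater_number_def using PV by (rule LeastI)
  then show ?thesis using degree_sequence_take[OF assms(1) le, of E] that by metis
qed

text \<open>Add to \<open>S\<close> the set \<open>U\<close> of vertices it does not dominate. The
  degree sum over \<open>S\<close> counts each edge inside \<open>S\<close> twice and each edge
  leaving \<open>S\<close> once; comparison with \<open>card V\<close> bounds \<open>card U\<close>
  by the excess.\<close>

lemma domination_number_le_excess:
  assumes G: "finite_simple_graph V E" and S: "S \<subseteq> V"
    and cV: "card V \<le> (\<Sum>v\<in>S. vertex_degree E v + 1)"
  shows "domination_number V E \<le> card S + excess (\<lambda>u v. {u, v} \<in> E) S (V - S)"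
proof -
  let ?r = "\<lambda>u v. {u, v} \<in> E" and ?N = "V - S"
  let ?d = "degree_in ?r S"
  define U where "U = {v\<in>?N. ?d v = 0}"
  have fin: "finite V" "finite S" "finite ?N" using G S finite_subset by (auto simp: finite_simple_graph_def)
  have "dominating_set V E (S \<union> U)"
    unfolding dominating_set_def
  proof (intro conjI ballI)
    fix v assume "v \<in> V - (S \<union> U)"
    then have "?d v \<noteq> 0" by (auto simp: U_def)
    then have "{u\<in>S. {v, u} \<in> E} \<noteq> {}" unfolding degree_in_def by (metis card.empty)
    then show "neighbors E v \<inter> (S \<union> U) \<noteq> {}" by (auto simp: neighbors_def insert_commute)
  qed (use S in \<open>auto simp: U_def\<close>)
  then have "domination_number V E \<le> card (S \<union> U)"
    unfolding domination_number_def by (intro Least_le) blast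
  also have "\<dots> = card S + card U" by (rule card_Un_disjoint) (use fin in \<open>auto simp: U_def\<close>)
  also have "card U \<le> excess ?r S ?N"
  proof -
    have r: "symp ?r" by (auto simp: symp_def insert_commute)
    have "vertex_degree E v = degree_in ?r V v" for v
    proof -
      have "neighbors E v = {u\<in>V. {v, u} \<in> E}"
        using G by (auto simp: neighbors_def finite_simple_graph_def insert_commute)
      then show ?thesis by (simp add: vertex_degree_def degree_in_def)
    qed
    moreover have "V = S \<union> ?N" using S by auto
    ultimately have "vertex_degree E v = ?d v + degree_in ?r ?N v" for v
      using degree_in_Un[OF fin(2,3), of ?r v] by simp
    then have "(\<Sum>v\<in>S. vertex_degree E v + 1) = (\<Sum>v\<in>S. ?d v) + (\<Sum>v\<in>?N. ?d v) + card S"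
      using sum_degree_in_swap[OF r fin(2,3)] by (simp add: sum.distrib sum_Suc)
    moreover have "card V = card S + card ?N"
      using card_Diff_subset[OF fin(2) S] card_mono[OF fin(1) S] by simp
    moreover have "card ?N = (\<Sum>v\<in>?N. 1)" by simp
    moreover have "card U = (\<Sum>v\<in>?N. if ?d v = 0 then 1 else 0)"
      using fin by (simp add: U_def sum.If_cases Int_def)
    \<comment> \<open>The truncated \<open>?d v - 1\<close> exceeds the true difference by one
      exactly when \<open>?d v = 0\<close>, that is on \<open>U\<close>.\<close>
    moreover have "(\<Sum>v\<in>?N. ?d v) + (\<Sum>v\<in>?N. if ?d v = 0 then 1 else 0) = (\<Sum>v\<in>?N. ?d v - 1) + (\<Sum>v\<in>?N. 1)"
      unfolding sum.distrib[symmetric] by (rule sum.cong) auto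
    ultimately show ?thesis using cV unfolding excess_def by linarith
  qed
  finally show ?thesis by simp
qed

theorem theorem8:
  fixes V :: "'a set" and E :: "'a set set"
  assumes "finite_simple_graph V E"
    and "outerplanar V E"
    and "slater_number V E \<ge> 2"
  shows "domination_number V E \<le> 6 * slater_number V E - 6"
proof -
  let ?r = "\<lambda>u v. {u, v} \<in> E"
  have fin: "finite V" using assms by (simp add: finite_simple_graph_def)
  obtain S where S: "S \<subseteq> V" "card S = slater_number V E"
    "card V \<le> (\<Sum>v\<in>S. vertex_degree E v + 1)"
    using slater_number_witness[OF fin assms(3)] by blast
  have "symp ?r" by (auto simp: symp_def insert_commute)
  moreover have "irreflp ?r" using assms(1) by (fastforce simp: irreflp_def finite_simple_graph_def)
  ultimately have "excess ?r S (V - S) + 6 \<le> 5 * card S"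
    using excess_le[OF fin _ _ outerplanar_no_K23_minor[OF assms(2)] S(1)] S(2) assms(3) by simp
  then show ?thesis
    using domination_number_le_excess[OF assms(1) S(1,3)] S(2) by linarith
qed

end
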